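(* Let $f,g_1,\ldots,g_m\in\mathbb{R}[x]$, $x=(x_1,\ldots,x_n)$, $g=(g_1,\ldots,g_m)$, $K=\{x\in\mathbb{R}^n:g_1(x)\ge0,\ldots,g_m(x)\ge0\}$, and let $S$ be the set of global minimizers of $f$ over $K$. For each order $k$ consider $$(\mathrm{MOM}_k)\qquad f_k^*:=\inf_{y\in\mathscr{M}_{2k}}\ \langle f,y\rangle\quad\text{s.t.}\quad L_{g_i}^{(k)}(y)\succeq 0\ (i=0,1,\ldots,m),\ \ \langle 1,y\rangle=1 .$$ Assume the archimedean condition holds: there exist $R>0$ and $k_0\in\mathbb{N}$ such that $R-\|x\|_2^2\in Q_{k_0}(g)$. Assume also that $S$ is nonempty and finite. Let $\{y^{(k)}\}$ be asymptotically optimal for $(\mathrm{MOM}_k)$, i.e. each $y^{(k)}$ is feasible for $(\mathrm{MOM}_k)$ and $\lim_{k\to\infty}\langle f,y^{(k)}\rangle=\lim_{k\to\infty}f_k^*$. Then for every integer $t\ge\max\{d_f,\ d_g+|S|-1\}$, the truncated sequence $\{y^{(k)}|_{2t}\}$ (over those $k\ge t$) is bounded, and every limit point of it belongs to $$F_{2t}:=\left\{\int_S[x]_{2t}\,d\mu:\ \mu\text{ a probability measure supported on }S\right\}$$ and is flat with respect to $g$.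
   Context: A polynomial is SOS if it is a sum of squares of polynomials with real coefficients. Set $g_0:=1$. $Q_k(g):=\{\sum_{i=0}^m g_i\sigma_i:\ \sigma_i\text{ SOS},\ \deg(g_i\sigma_i)\le 2k\ \forall i\}$. $\|x\|_2^2=x_1^2+\cdots+x_n^2$. Degrees: $d_i=\lceil\deg(g_i)/2\rceil$, $d_g=\max\{1,d_1,\ldots,d_m\}$, $d_f=\lceil\deg(f)/2\rceil$. $\mathscr{M}_{2k}$ is the space of truncated moment sequences (tms) $y=(y_\alpha)$ indexed by $\alpha\in\mathbb{N}^n$ with $|\alpha|=\alpha_1+\cdots+\alpha_n\le 2k$ ($\mathbb{N}$ includes $0$). For $p=\sum_\alpha p_\alpha x^\alpha$ of degree at most $2k$, $\langle p,y\rangle:=\mathscr{L}_y(p):=\sum_\alpha p_\alpha y_\alpha$. For $t\le k$, $y|_{2t}:=(y_\alpha)_{|\alpha|\le2t}$. $[x]_{2t}$ is the vector of all monomials $x^\alpha$ with $|\alpha|\le2t$. For $h\in\mathbb{R}[x]$ with $d_h:=\lceil\deg(h)/2\rceil\le k$, the localizing matrix $L_h^{(k)}(y)$ is the symmetric matrix, indexed by $\alpha\in\mathbb{N}^n$ with $|\alpha|\le k-d_h$, such that $p^TL_h^{(k)}(y)q=\mathscr{L}_y(hpq)$ for all polynomials $p,q$ of degree at most $k-d_h$ (polynomials identified with their coefficient vectors). The moment matrix is $M_k(y):=L_1^{(k)}(y)$; $M_s(y):=M_s(y|_{2s})$ for $s\le k$. $X\succeq0$ means positive semidefinite. $(\mathrm{MOM}_k)$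 is considered for $k\ge\max\{d_f,d_g\}$. A tms $z\in\mathscr{M}_{2t}$ is flat with respect to $g$ if it is feasible for $(\mathrm{MOM}_t)$ and $\operatorname{rank}M_{t-d_g}(z)=\operatorname{rank}M_t(z)$. *)

theory Defs
  imports "HOL-Probability.Probability" "HOL-Analysis.Finite_Function_Topology"
begin

section \<open>Polynomials in the variables \<open>x\<^sub>i\<close>, \<open>i :: 'n\<close>\<close>

text \<open>Exponent vectors are finitely supported maps \<open>'n \<Rightarrow>\<^sub>0 nat\<close>, and real polynomials are finitely
  supported maps from exponent vectors to coefficients; their ring structure (convolution product)
  is the one of \<^theory>\<open>HOL-Library.Poly_Mapping\<close>.  The number of variables is \<open>CARD('n)\<close>.\<close>

type_synonym 'n expo = "'n \<Rightarrow>\<^sub>0 nat"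
type_synonym 'n mpoly = "'n expo \<Rightarrow>\<^sub>0 real"

definition expo_deg :: "'n::finite expo \<Rightarrow> nat" where
  "expo_deg \<alpha> = (\<Sum>i\<in>UNIV. Poly_Mapping.lookup \<alpha> i)"

definition expos :: "nat \<Rightarrow> 'n::finite expo set" where
  "expos d = {\<alpha>. expo_deg \<alpha> \<le> d}"

definition mon_eval :: "'n::finite expo \<Rightarrow> real ^ 'n \<Rightarrow> real" where
  "mon_eval \<alpha> x = (\<Prod>i\<in>UNIV. (x $ i) ^ Poly_Mapping.lookup \<alpha> i)"

definition poly_eval :: "'n::finite mpoly \<Rightarrow> real ^ 'n \<Rightarrow> real" where
  "poly_eval p x = (\<Sum>\<alpha>\<in>Poly_Mapping.keys p. Poly_Mapping.lookup p \<alpha> * mon_eval \<alpha> x)"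

definition monomial :: "'n expo \<Rightarrow> 'n mpoly" where
  "monomial \<alpha> = Poly_Mapping.single \<alpha> 1"

definition const_poly :: "real \<Rightarrow> 'n mpoly" where
  "const_poly c = Poly_Mapping.single 0 c"

definition var_poly :: "'n \<Rightarrow> 'n mpoly" where
  "var_poly i = monomial (Poly_Mapping.single i 1)"

definition sq_norm_poly :: "'n::finite mpoly" where
  "sq_norm_poly = (\<Sum>i\<in>UNIV. (var_poly i)\<^sup>2)"

text \<open>The total degree; the zero polynomial gets degree \<open>0\<close>.\<close>

definition total_deg :: "'n::finite mpoly \<Rightarrow> nat" where
  "total_deg p = Max (insert 0 (expo_deg ` Poly_Mapping.keys p))"

definition half_deg :: "'n::finite mpoly \<Rightarrow> nat" where
  "half_deg p = nat \<lceil>real (total_deg p) / 2\<rceil>"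

definition sos :: "'n mpoly \<Rightarrow> bool" where
  "sos \<sigma> \<longleftrightarrow> (\<exists>ps. \<sigma> = (\<Sum>p\<leftarrow>ps. p\<^sup>2))"


section \<open>The constraint tuple and the optimization problem\<close>

text \<open>The tuple \<open>(g\<^sub>1, \<dots>, g\<^sub>m)\<close> is a list \<open>g\<close> of length \<open>m\<close>.  The list \<open>1 # g\<close> then has
  exactly the entries \<open>g\<^sub>0 = 1, g\<^sub>1, \<dots>, g\<^sub>m\<close> at the positions \<open>0, \<dots>, m\<close>.\<close>

definition quadratic_module :: "nat \<Rightarrow> 'n::finite mpoly list \<Rightarrow> 'n mpoly set" where
  "quadratic_module k g =
     {\<Sum>i\<le>length g. ((1 # g) ! i) * \<sigma> i | \<sigma>.
        \<forall>i\<le>length g. sos (\<sigma> i) \<and> total_deg (((1 # g) ! i) * \<sigma> i) \<le> 2 * k}"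

definition constr_deg :: "'n::finite mpoly list \<Rightarrow> nat" where
  "constr_deg g = Max (insert 1 (half_deg ` set g))"

definition feasible_set :: "'n::finite mpoly list \<Rightarrow> (real ^ 'n) set" where
  "feasible_set g = {x. \<forall>h\<in>set g. poly_eval h x \<ge> 0}"

definition minimizers :: "'n::finite mpoly \<Rightarrow> 'n mpoly list \<Rightarrow> (real ^ 'n) set" where
  "minimizers f g =
     {x \<in> feasible_set g. \<forall>u\<in>feasible_set g. poly_eval f x \<le> poly_eval f u}"


section \<open>Truncated moment sequences\<close>

text \<open>A tms of degree \<open>d\<close> is a family of reals indexed by the exponents of degree at most \<open>d\<close>,
  extended by zero to all exponents.  In this way \<open>tms_space d\<close> is a finite-dimensional subspace
  of the normed space \<open>'n expo \<Rightarrow>\<^sub>0 real\<close> from \<^theory>\<open>HOL-Analysis.Finite_Function_Topology\<close>,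
  which supplies boundedness and convergence.\<close>

type_synonym 'n tms = "'n expo \<Rightarrow>\<^sub>0 real"

definition tms_space :: "nat \<Rightarrow> 'n::finite tms set" where
  "tms_space d = {y. Poly_Mapping.keys y \<subseteq> expos d}"

definition tms_trunc :: "nat \<Rightarrow> 'n::finite tms \<Rightarrow> 'n tms" where
  "tms_trunc d y = (\<Sum>\<alpha>\<in>expos d. Poly_Mapping.single \<alpha> (Poly_Mapping.lookup y \<alpha>))"

definition riesz :: "'n tms \<Rightarrow> 'n mpoly \<Rightarrow> real" where
  "riesz y p = (\<Sum>\<alpha>\<in>Poly_Mapping.keys p. Poly_Mapping.lookup p \<alpha> * Poly_Mapping.lookup y \<alpha>)"


section \<open>Localizing and moment matrices\<close>

text \<open>Square matrices are functions of two indices together with a finite index set \<open>A\<close>; only the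
  entries with both indices in \<open>A\<close> matter.\<close>

definition psd_on :: "'a set \<Rightarrow> ('a \<Rightarrow> 'a \<Rightarrow> real) \<Rightarrow> bool" where
  "psd_on A M \<longleftrightarrow> (\<forall>\<alpha>\<in>A. \<forall>\<beta>\<in>A. M \<alpha> \<beta> = M \<beta> \<alpha>) \<and>
     (\<forall>v. (\<Sum>\<alpha>\<in>A. \<Sum>\<beta>\<in>A. v \<alpha> * M \<alpha> \<beta> * v \<beta>) \<ge> 0)"

text \<open>The rank is the dimension of the column space.\<close>

definition column_on :: "'a set \<Rightarrow> ('a \<Rightarrow> 'a \<Rightarrow> real) \<Rightarrow> 'a \<Rightarrow> ('a \<Rightarrow>\<^sub>0 real)" where
  "column_on A M \<beta> = (\<Sum>\<alpha>\<in>A. Poly_Mapping.single \<alpha> (M \<alpha> \<beta>))"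

definition rank_on :: "'a set \<Rightarrow> ('a \<Rightarrow> 'a \<Rightarrow> real) \<Rightarrow> nat" where
  "rank_on A M = dim (column_on A M ` A)"

text \<open>The entries of the localizing matrix do not depend on the order \<open>k\<close>; only its index set
  \<open>loc_index h k\<close> does.\<close>

definition loc_index :: "'n::finite mpoly \<Rightarrow> nat \<Rightarrow> 'n expo set" where
  "loc_index h k = expos (k - half_deg h)"

definition loc_mat :: "'n::finite mpoly \<Rightarrow> 'n tms \<Rightarrow> 'n expo \<Rightarrow> 'n expo \<Rightarrow> real" where
  "loc_mat h y \<alpha> \<beta> = riesz y (h * monomial \<alpha> * monomial \<beta>)"

definition moment_rank :: "nat \<Rightarrow> 'n::finite tms \<Rightarrow> nat" where
  "moment_rank s y = rank_on (loc_index 1 s) (loc_mat 1 (tms_trunc (2 * s) y))"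

lemma finite_expos [simp]: "finite (expos d :: 'n::finite expo set)"
proof (rule finite_imageD)
  show "inj_on Poly_Mapping.lookup (expos d :: 'n expo set)"
    by (simp add: inj_on_def)
  have "Poly_Mapping.lookup ` (expos d :: 'n expo set) \<subseteq> Pi\<^sub>E UNIV (\<lambda>_. {..d})"
  proof (safe; simp add: PiE_iff)
    fix \<alpha> :: "'n expo" and i assume "\<alpha> \<in> expos d"
    moreover have "Poly_Mapping.lookup \<alpha> i \<le> expo_deg \<alpha>"
      unfolding expo_deg_def by (rule member_le_sum) auto
    ultimately show "Poly_Mapping.lookup \<alpha> i \<le> d"
      by (simp add: expos_def)
  qed
  then show "finite (Poly_Mapping.lookup ` (expos d :: 'n expo set))"
    by (rule finite_subset) (simp add: finite_PiE)
qed

lemma lookup_tms_trunc: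
  "Poly_Mapping.lookup (tms_trunc d y) \<alpha> = (if \<alpha> \<in> expos d then Poly_Mapping.lookup y \<alpha> else 0)"
proof -
  have "Poly_Mapping.lookup (tms_trunc d y) \<alpha> =
      (\<Sum>\<beta>\<in>expos d. if \<beta> = \<alpha> then Poly_Mapping.lookup y \<beta> else 0)"
    unfolding tms_trunc_def lookup_sum
    by (rule sum.cong) (auto simp: lookup_single when_def)
  then show ?thesis by simp
qed

lemma riesz_superset:
  assumes "finite B" "Poly_Mapping.keys p \<subseteq> B"
  shows "riesz y p = (\<Sum>\<alpha>\<in>B. Poly_Mapping.lookup p \<alpha> * Poly_Mapping.lookup y \<alpha>)"
  unfolding riesz_def using assms
  by (intro sum.mono_neutral_left) (auto simp: in_keys_iff)

lemma riesz_add: "riesz y (p + q) = riesz y p + riesz y q"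
proof -
  let ?B = "Poly_Mapping.keys p \<union> Poly_Mapping.keys q"
  have "Poly_Mapping.keys (p + q) \<subseteq> ?B" by (rule keys_add)
  then show ?thesis
    by (simp add: riesz_superset[of ?B] lookup_add distrib_right sum.distrib)
qed

lemma riesz_zero: "riesz y 0 = 0"
  by (simp add: riesz_def)

lemma riesz_sum: "riesz y (\<Sum>i\<in>I. p i) = (\<Sum>i\<in>I. riesz y (p i))"
  by (induction I rule: infinite_finite_induct) (simp_all add: riesz_add riesz_zero)

lemma riesz_const: "riesz y (const_poly c * p) = c * riesz y p"
proof -
  have lk: "Poly_Mapping.lookup (const_poly c * p) \<alpha> = c * Poly_Mapping.lookup p \<alpha>" for \<alpha>
    by (simp add: const_poly_def mult_map_scale_conv_mult[symmetric] map.rep_eq when_def)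
  then have "Poly_Mapping.keys (const_poly c * p) \<subseteq> Poly_Mapping.keys p"
    by (auto simp: in_keys_iff)
  then show ?thesis
    by (simp add: riesz_superset[of "Poly_Mapping.keys p"] lk sum_distrib_left mult.assoc)
qed

lemma poly_as_sum:
  assumes "total_deg p \<le> d"
  shows "p = (\<Sum>\<alpha>\<in>expos d. const_poly (Poly_Mapping.lookup p \<alpha>) * monomial \<alpha>)"
proof (rule poly_mapping_eqI)
  fix \<beta>
  have k: "Poly_Mapping.keys p \<subseteq> expos d"
  proof
    fix \<alpha> assume "\<alpha> \<in> Poly_Mapping.keys p"
    then have "expo_deg \<alpha> \<le> total_deg p" unfolding total_deg_def by (intro Max_ge) auto
    with assms show "\<alpha> \<in> expos d" by (simp add: expos_def)
  qed
  have "Poly_Mapping.lookup (\<Sum>\<alpha>\<in>expos d. const_poly (Poly_Mapping.lookup p \<alpha>) * monomial \<alpha>) \<beta>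
      = (\<Sum>\<alpha>\<in>expos d. if \<alpha> = \<beta> then Poly_Mapping.lookup p \<alpha> else 0)"
    unfolding lookup_sum const_poly_def monomial_def
    by (rule sum.cong) (auto simp: mult_single lookup_single when_def)
  also have "\<dots> = Poly_Mapping.lookup p \<beta>"
    using k by (auto simp: in_keys_iff)
  finally show "Poly_Mapping.lookup p \<beta> =
    Poly_Mapping.lookup (\<Sum>\<alpha>\<in>expos d. const_poly (Poly_Mapping.lookup p \<alpha>) * monomial \<alpha>) \<beta>" ..
qed

text \<open>The characterizing property of the localizing matrix of order \<open>k\<close>: with polynomials
  identified with their coefficient vectors, it represents the bilinear form
  \<open>(p, q) \<mapsto> riesz y (h * p * q)\<close>, and it is the only matrix that does so.\<close>

lemma loc_mat_bilinear:
  assumes "total_deg p \<le> k - half_deg h" "total_deg q \<le> k - half_deg h"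
  shows "(\<Sum>\<alpha>\<in>loc_index h k. \<Sum>\<beta>\<in>loc_index h k.
            Poly_Mapping.lookup p \<alpha> * loc_mat h y \<alpha> \<beta> * Poly_Mapping.lookup q \<beta>)
         = riesz y (h * p * q)"
proof -
  let ?A = "expos (k - half_deg h)"
  let ?c = "\<lambda>r \<alpha>. const_poly (Poly_Mapping.lookup r \<alpha>)"
  have "h * p * q = h * (\<Sum>\<alpha>\<in>?A. ?c p \<alpha> * monomial \<alpha>) * (\<Sum>\<beta>\<in>?A. ?c q \<beta> * monomial \<beta>)"
    using poly_as_sum[OF assms(1)] poly_as_sum[OF assms(2)] by simp
  also have "\<dots> = (\<Sum>\<alpha>\<in>?A. \<Sum>\<beta>\<in>?A. ?c p \<alpha> * (?c q \<beta> * (h * monomial \<alpha> * monomial \<beta>)))"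
    by (simp add: sum_distrib_left sum_distrib_right mult_ac)
  finally have "riesz y (h * p * q) = (\<Sum>\<alpha>\<in>?A. \<Sum>\<beta>\<in>?A.
      Poly_Mapping.lookup p \<alpha> * (Poly_Mapping.lookup q \<beta> * loc_mat h y \<alpha> \<beta>))"
    by (simp only: riesz_sum riesz_const loc_mat_def)
  then show ?thesis
    by (simp add: loc_index_def mult_ac)
qed

lemma total_deg_monomial: "total_deg (monomial \<alpha>) = expo_deg \<alpha>"
  by (simp add: total_deg_def monomial_def)

lemma loc_mat_unique:
  assumes "\<And>p q. total_deg p \<le> k - half_deg h \<Longrightarrow> total_deg q \<le> k - half_deg h \<Longrightarrow>
      (\<Sum>\<alpha>\<in>loc_index h k. \<Sum>\<beta>\<in>loc_index h k.
         Poly_Mapping.lookup p \<alpha> * N \<alpha> \<beta> * Poly_Mapping.lookup q \<beta>) = riesz y (h * p * q)"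
    and "\<alpha> \<in> loc_index h k" "\<beta> \<in> loc_index h k"
  shows "N \<alpha> \<beta> = loc_mat h y \<alpha> \<beta>"
proof -
  have fin: "finite (loc_index h k)" by (simp add: loc_index_def)
  have lk: "Poly_Mapping.lookup (monomial \<gamma>) \<delta> = (if \<gamma> = \<delta> then 1 else 0)" for \<gamma> \<delta> :: "'a expo"
    by (simp add: monomial_def lookup_single when_def)
  have "(\<Sum>\<gamma>\<in>loc_index h k. \<Sum>\<delta>\<in>loc_index h k.
           Poly_Mapping.lookup (monomial \<alpha>) \<gamma> * N \<gamma> \<delta> * Poly_Mapping.lookup (monomial \<beta>) \<delta>)
      = (\<Sum>\<gamma>\<in>loc_index h k. \<Sum>\<delta>\<in>loc_index h k. if \<beta> = \<delta> then if \<alpha> = \<gamma> then N \<gamma> \<delta> else 0 else 0)"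
    by (intro sum.cong) (auto simp: lk)
  also have "\<dots> = N \<alpha> \<beta>"
    using assms(2,3) fin by simp
  finally show ?thesis
    using assms(1)[of "monomial \<alpha>" "monomial \<beta>"] assms(2,3)
    by (simp add: total_deg_monomial loc_index_def expos_def loc_mat_def)
qed


section \<open>The moment relaxations\<close>

definition mom_feasible :: "'n::finite mpoly list \<Rightarrow> nat \<Rightarrow> 'n tms \<Rightarrow> bool" where
  "mom_feasible g k y \<longleftrightarrow> y \<in> tms_space (2 * k) \<and>
     (\<forall>h\<in>set (1 # g). psd_on (loc_index h k) (loc_mat h y)) \<and> riesz y 1 = 1"

text \<open>The optimal value is taken in the extended reals, since low-order relaxations may be
  unbounded below.\<close>

definition mom_value :: "'n::finite mpoly \<Rightarrow> 'n mpoly list \<Rightarrow> nat \<Rightarrow> ereal" where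
  "mom_value f g k = (INF y\<in>{y. mom_feasible g k y}. ereal (riesz y f))"

definition asymptotically_optimal ::
    "'n::finite mpoly \<Rightarrow> 'n mpoly list \<Rightarrow> (nat \<Rightarrow> 'n tms) \<Rightarrow> bool" where
  "asymptotically_optimal f g y \<longleftrightarrow>
     (\<forall>k\<ge>max (half_deg f) (constr_deg g). mom_feasible g k (y k)) \<and>
     (\<exists>L::ereal. (\<lambda>k. ereal (riesz (y k) f)) \<longlonglongrightarrow> L \<and> mom_value f g \<longlonglongrightarrow> L)"

text \<open>Only meant for \<open>constr_deg g \<le> t\<close>, where the truncated subtraction is exact.\<close>

definition flat_tms :: "'n::finite mpoly list \<Rightarrow> nat \<Rightarrow> 'n tms \<Rightarrow> bool" where
  "flat_tms g t z \<longleftrightarrow>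
     mom_feasible g t z \<and> moment_rank (t - constr_deg g) z = moment_rank t z"

definition moment_set :: "(real ^ 'n::finite) set \<Rightarrow> nat \<Rightarrow> 'n tms set" where
  "moment_set S d =
     {z \<in> tms_space d. \<exists>\<mu> :: (real ^ 'n) measure.
        sets \<mu> = sets borel \<and> prob_space \<mu> \<and> (AE x in \<mu>. x \<in> S) \<and>
        (\<forall>\<alpha>\<in>expos d. Poly_Mapping.lookup z \<alpha> = (LINT x:S|\<mu>. mon_eval \<alpha> x))}"

definition seq_limit_point :: "(nat \<Rightarrow> 'a::topological_space) \<Rightarrow> 'a \<Rightarrow> bool" where
  "seq_limit_point X z \<longleftrightarrow> (\<exists>r::nat \<Rightarrow> nat. strict_mono r \<and> (X \<circ> r) \<longlonglongrightarrow> z)"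

end

theory Submission
  imports Defs
begin

text \<open>A limit point \<open>z\<close> of the truncations is controlled by what the whole sequence \<open>y\<close> does at higher and
  higher orders.  The archimedean condition bounds each entry of \<open>y k\<close> for large \<open>k\<close>
  (\<open>eventually_moment_le\<close>), which gives boundedness of the truncations.  By a diagonal argument a
  subsequence that realizes the limit point \<open>z\<close> can be thinned out until all moments converge.  The
  result is a linear functional \<open>L\<close> on all polynomials with \<open>L 1 = 1\<close>, with \<open>L (h * q\<^sup>2) \<ge> 0\<close> for
  every constraint \<open>h\<close> and for \<open>h = 1\<close>, with moments that grow at most exponentially, and with \<open>L f\<close> at
  most the minimum of \<open>f\<close>, since point masses at minimizers are feasible for every relaxation.

  The heart of the matter is that such an \<open>L\<close> is a convex combination of evaluations at the
  minimizers.  The classical route represents \<open>L\<close> by a measure, using Putinar's theorem, and then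
  looks at its support.  Here a direct argument is given that never constructs a
  representing measure for a general functional.

  First, \<open>L\<close> is bounded below on each polynomial by the values on a box
  (\<open>exists_point_value_le\<close>).  Iterating the Cauchy-Schwarz inequality, the growth bound on the
  moments shows that \<open>L\<close> is nonnegative on all products of the polynomials \<open>\<rho> + x\<^sub>i\<close> and
  \<open>\<rho> - x\<^sub>i\<close>, in particular on Bernstein polynomials for the box \<open>[-\<rho>, \<rho>]\<^sup>n\<close>.  Exact Bernstein
  expansions exhibit \<open>L p\<close> as a convex combination of coefficients that approach values of \<open>p\<close>.

  Second, the constraints come in through explicit penalty terms \<open>s * (1 - s) ^ (2 N)\<close>, which are
  multiples of a constraint by a square: polynomials that are positive on the feasible part of
  the box have a nonnegative value (\<open>nonneg_if_positive_on_feasible\<close>).  Adding a large multiple of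
  \<open>f\<close> minus its minimum improves this to all polynomials that are nonnegative on the minimizers
  (\<open>nonneg_if_nonneg_on_minimizers\<close>).  As there are finitely many minimizers, Lagrange interpolation turns this
  into the asserted combination (\<open>atomic_representation\<close>).

  So \<open>z\<close> is the tms of a probability measure on the minimizers.  It is feasible because its atoms are,
  and its moment matrices of all orders from \<open>card S - 1\<close> on have rank equal to the number of
  atoms (\<open>moment_rank_atoms\<close>).  Both orders \<open>t - d\<^sub>g\<close> and \<open>t\<close> are in this range, which is flatness.\<close>

section \<open>Polynomials as a real algebra\<close>

lemma lookup_scaleR [simp]:
  "Poly_Mapping.lookup (c *\<^sub>R p) \<alpha> = c *\<^sub>R Poly_Mapping.lookup p \<alpha>"
  unfolding scaleR_poly_mapping_def
  by (subst lookup_Abs_poly_mapping) (auto intro: finite_subset[OF _ finite_lookup[of p]])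

lemma scaleR_conv_single_mult:
  fixes p :: "'a::comm_monoid_add \<Rightarrow>\<^sub>0 'b::{real_algebra_1, comm_ring_1}"
  shows "c *\<^sub>R p = Poly_Mapping.single 0 (of_real c) * p"
  by (rule poly_mapping_eqI)
     (simp add: mult_map_scale_conv_mult[symmetric] map.rep_eq when_def scaleR_conv_of_real)

text \<open>With this instance scalar multiples pass through products by the general algebra rules, so
  that functionals on polynomials can be treated by the theory of \<^const>\<open>linear\<close> maps.\<close>
instance poly_mapping :: (comm_monoid_add, "{real_algebra_1, comm_ring_1}") real_algebra_1
  by standard (simp_all add: scaleR_conv_single_mult mult_ac)

lemma const_poly_conv_scaleR: "const_poly c = c *\<^sub>R (1 :: 'n mpoly)"
  by (simp add: const_poly_def scaleR_conv_single_mult)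

lemma poly_expand:
  fixes p :: "'n mpoly"
  shows "p = (\<Sum>\<alpha>\<in>Poly_Mapping.keys p. Poly_Mapping.lookup p \<alpha> *\<^sub>R monomial \<alpha>)"
  by (rule poly_mapping_eqI)
     (auto simp: lookup_sum monomial_def lookup_single when_def in_keys_iff if_distrib cong: if_cong)

lemma monomial_add: "monomial (\<alpha> + \<beta>) = monomial \<alpha> * monomial \<beta>"
  by (simp add: monomial_def mult_single)

lemma monomial_0 [simp]: "monomial 0 = 1"
  by (simp add: monomial_def)

lemma monomial_sum: "monomial (\<Sum>i\<in>I. \<alpha> i) = (\<Prod>i\<in>I. monomial (\<alpha> i))"
  by (induction I rule: infinite_finite_induct) (simp_all add: monomial_add)

lemma var_poly_power: "var_poly i ^ k = monomial (Poly_Mapping.single i k)"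
proof (induction k)
  case (Suc k)
  have "Poly_Mapping.single i (Suc k) = Poly_Mapping.single i 1 + Poly_Mapping.single i k"
    by (simp add: single_add[symmetric])
  with Suc show ?case by (simp add: var_poly_def monomial_add)
qed simp

lemma monomial_conv_prod:
  "monomial \<alpha> = (\<Prod>i\<in>UNIV. var_poly (i :: 'n::finite) ^ Poly_Mapping.lookup \<alpha> i)"
proof -
  have "\<alpha> = (\<Sum>i\<in>UNIV. Poly_Mapping.single i (Poly_Mapping.lookup \<alpha> i))"
    by (rule poly_mapping_eqI) (simp add: lookup_sum lookup_single when_def)
  then show ?thesis
    by (metis (no_types, lifting) monomial_sum prod.cong var_poly_power)
qed

lemma expo_deg_0 [simp]: "expo_deg 0 = 0"
  by (simp add: expo_deg_def)

lemma expo_deg_add: "expo_deg (\<alpha> + \<beta>) = expo_deg \<alpha> + expo_deg \<beta>"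
  by (simp add: expo_deg_def lookup_add sum.distrib)

lemma expo_deg_single [simp]: "expo_deg (Poly_Mapping.single i k) = k"
  by (simp add: expo_deg_def lookup_single when_def)

lemma total_deg_le_iff: "total_deg p \<le> d \<longleftrightarrow> Poly_Mapping.keys p \<subseteq> expos d"
  by (auto simp: total_deg_def expos_def)

lemma total_deg_mult: "total_deg (p * q) \<le> total_deg p + total_deg q"
  unfolding total_deg_le_iff
proof
  fix \<gamma> assume "\<gamma> \<in> Poly_Mapping.keys (p * q)"
  then obtain \<alpha> \<beta> where "\<gamma> = \<alpha> + \<beta>" "\<alpha> \<in> Poly_Mapping.keys p" "\<beta> \<in> Poly_Mapping.keys q"
    using keys_mult[of p q] by blast
  moreover have "Poly_Mapping.keys p \<subseteq> expos (total_deg p)" "Poly_Mapping.keys q \<subseteq> expos (total_deg q)"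
    by (simp_all flip: total_deg_le_iff)
  ultimately show "\<gamma> \<in> expos (total_deg p + total_deg q)"
    by (auto simp: expos_def expo_deg_add intro!: add_mono)
qed

lemma total_deg_prod:
  "total_deg (\<Prod>i\<in>I. p i) \<le> (\<Sum>i\<in>I. total_deg (p i))"
proof (induction I rule: infinite_finite_induct)
  case (insert i I)
  then show ?case using total_deg_mult[of "p i" "\<Prod>i\<in>I. p i"] by simp
qed (simp_all add: total_deg_def)

lemma half_deg_bound: "total_deg p \<le> 2 * half_deg p"
  unfolding half_deg_def by linarith

lemma half_deg_1 [simp]: "half_deg 1 = 0"
  by (simp add: half_deg_def total_deg_def)

section \<open>Linear functionals\<close>

text \<open>A tms has finitely many nonzero entries, but the moments of a limit of tms of growing order
  have no such restriction.  Arbitrary families \<open>\<phi>\<close> are therefore allowed here; both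
  \<^const>\<open>riesz\<close> and point evaluation are instances.\<close>

definition moment_functional :: "('n expo \<Rightarrow> real) \<Rightarrow> 'n mpoly \<Rightarrow> real" where
  "moment_functional \<phi> p = (\<Sum>\<alpha>\<in>Poly_Mapping.keys p. Poly_Mapping.lookup p \<alpha> * \<phi> \<alpha>)"

lemma moment_functional_superset:
  assumes "finite B" "Poly_Mapping.keys p \<subseteq> B"
  shows "moment_functional \<phi> p = (\<Sum>\<alpha>\<in>B. Poly_Mapping.lookup p \<alpha> * \<phi> \<alpha>)"
  unfolding moment_functional_def using assms
  by (intro sum.mono_neutral_left) (auto simp: in_keys_iff)

lemma linear_moment_functional [simp]: "linear (moment_functional \<phi>)"
proof (rule linearI)
  fix p q :: "'a mpoly" and c :: real
  let ?B = "Poly_Mapping.keys p \<union> Poly_Mapping.keys q"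
  have "Poly_Mapping.keys (p + q) \<subseteq> ?B" by (rule keys_add)
  then show "moment_functional \<phi> (p + q) = moment_functional \<phi> p + moment_functional \<phi> q"
    by (simp add: moment_functional_superset[of ?B] lookup_add distrib_right sum.distrib)
  have "Poly_Mapping.keys (c *\<^sub>R p) \<subseteq> Poly_Mapping.keys p"
    by (auto simp: in_keys_iff)
  then show "moment_functional \<phi> (c *\<^sub>R p) = c *\<^sub>R moment_functional \<phi> p"
    by (simp add: moment_functional_superset[of "Poly_Mapping.keys p"] sum_distrib_left mult.assoc)
qed

lemma moment_functional_monomial [simp]: "moment_functional \<phi> (monomial \<alpha>) = \<phi> \<alpha>"
  by (simp add: moment_functional_def monomial_def)

lemma linear_on_poly:
  fixes L :: "'n mpoly \<Rightarrow> real"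
  assumes "linear L"
  shows "L p = moment_functional (\<lambda>\<alpha>. L (monomial \<alpha>)) p"
proof -
  have "L p = L (\<Sum>\<alpha>\<in>Poly_Mapping.keys p. Poly_Mapping.lookup p \<alpha> *\<^sub>R monomial \<alpha>)"
    using poly_expand[of p] by simp
  then show ?thesis
    by (simp add: linear_sum[OF assms] linear_cmul[OF assms] moment_functional_def)
qed

lemma linear_ext_monomial:
  fixes L M :: "'n mpoly \<Rightarrow> real"
  assumes "linear L" "linear M" "\<And>\<alpha>. L (monomial \<alpha>) = M (monomial \<alpha>)"
  shows "L p = M p"
  unfolding linear_on_poly[OF assms(1), of p] linear_on_poly[OF assms(2), of p] assms(3) ..

lemma linear_compose_mult:
  assumes "linear L"
  shows "linear (\<lambda>p. L (h * p :: 'n mpoly) :: real)"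
  using assms by (simp add: linear_iff distrib_left)

lemma linear_compose_mult_right:
  assumes "linear L"
  shows "linear (\<lambda>p. L (p * h :: 'n mpoly) :: real)"
  using assms by (simp add: linear_iff distrib_right)

lemma riesz_conv: "riesz y = moment_functional (Poly_Mapping.lookup y)"
  by (simp add: riesz_def moment_functional_def fun_eq_iff)

lemma linear_riesz [simp]: "linear (riesz y)"
  by (simp add: riesz_conv)

lemma riesz_monomial [simp]: "riesz y (monomial \<alpha>) = Poly_Mapping.lookup y \<alpha>"
  by (simp add: riesz_conv)

subsection \<open>Evaluation at a point\<close>

lemma mon_eval_0 [simp]: "mon_eval 0 x = 1"
  by (simp add: mon_eval_def)

lemma mon_eval_add: "mon_eval (\<alpha> + \<beta>) x = mon_eval \<alpha> x * mon_eval \<beta> x"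
  by (simp add: mon_eval_def lookup_add power_add prod.distrib)

lemma poly_eval_conv: "(\<lambda>p. poly_eval p x) = moment_functional (\<lambda>\<alpha>. mon_eval \<alpha> x)"
  by (simp add: poly_eval_def moment_functional_def fun_eq_iff)

lemma linear_poly_eval [simp]: "linear (\<lambda>p. poly_eval p x)"
  by (simp add: poly_eval_conv)

lemma poly_eval_monomial [simp]: "poly_eval (monomial \<alpha>) x = mon_eval \<alpha> x"
  using fun_cong[OF poly_eval_conv, of "monomial \<alpha>" x] by simp

lemmas poly_eval_add [simp] = linear_add[OF linear_poly_eval]
  and poly_eval_diff [simp] = linear_diff[OF linear_poly_eval]
  and poly_eval_scaleR [simp] = linear_cmul[OF linear_poly_eval]
  and poly_eval_sum [simp] = linear_sum[OF linear_poly_eval]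
  and poly_eval_0 [simp] = linear_0[OF linear_poly_eval]

lemma poly_eval_1 [simp]: "poly_eval 1 x = 1"
  using poly_eval_monomial[of 0 x] by simp

text \<open>Both sides are bilinear, so it is enough to compare them on monomials.\<close>
lemma poly_eval_mult [simp]: "poly_eval (p * q) x = poly_eval p x * poly_eval q x"
proof -
  have 1: "poly_eval (monomial \<alpha> * q) x = mon_eval \<alpha> x * poly_eval q x" for \<alpha> q
  proof (rule linear_ext_monomial)
    show "linear (\<lambda>q. poly_eval (monomial \<alpha> * q) x)"
      by (rule linear_compose_mult) simp
    show "linear (\<lambda>q. mon_eval \<alpha> x * poly_eval q x)"
      by (simp add: linear_iff algebra_simps)
  qed (simp add: monomial_add[symmetric] mon_eval_add)
  show ?thesis
  proof (rule linear_ext_monomial[where p = p])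
    show "linear (\<lambda>p. poly_eval (p * q) x)"
      by (rule linear_compose_mult_right) simp
    show "linear (\<lambda>p. poly_eval p x * poly_eval q x)"
      by (simp add: linear_iff algebra_simps)
  qed (simp add: 1)
qed

lemma poly_eval_power [simp]: "poly_eval (p ^ k) x = poly_eval p x ^ k"
  by (induction k) simp_all

lemma poly_eval_prod [simp]: "poly_eval (\<Prod>i\<in>I. p i) x = (\<Prod>i\<in>I. poly_eval (p i) x)"
  by (induction I rule: infinite_finite_induct) simp_all

lemma poly_eval_var [simp]: "poly_eval (var_poly i) x = x $ i"
proof -
  have "mon_eval (Poly_Mapping.single i 1) x = (\<Prod>j\<in>UNIV. if j = i then x $ i else 1)"
    unfolding mon_eval_def by (intro prod.cong) (auto simp: lookup_single when_def)
  then show ?thesis by (simp add: var_poly_def)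
qed

lemma continuous_on_poly_eval [continuous_intros]:
  "continuous_on A (poly_eval p)"
  unfolding poly_eval_def mon_eval_def by (intro continuous_intros)

section \<open>Positive functionals with bounded moments\<close>

text \<open>The quadratic \<open>c \<mapsto> L ((p + c q)\<^sup>2)\<close> is nonnegative, hence its discriminant is not positive.
  If its leading coefficient \<open>L (q\<^sup>2)\<close> is zero, then it is affine in \<open>c\<close> and must be constant.\<close>
lemma positive_functional_Cauchy_Schwarz:
  fixes L :: "'n mpoly \<Rightarrow> real"
  assumes "linear L" and pos: "\<And>q. 0 \<le> L (q\<^sup>2)"
  shows "(L (p * q))\<^sup>2 \<le> L (p\<^sup>2) * L (q\<^sup>2)"
proof -
  interpret linear L by fact
  have quad: "0 \<le> L (p\<^sup>2) + 2 * c * L (p * q) + c\<^sup>2 * L (q\<^sup>2)" for c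
  proof -
    have "(p + c *\<^sub>R q)\<^sup>2 = p\<^sup>2 + (2 * c) *\<^sub>R (p * q) + c\<^sup>2 *\<^sub>R q\<^sup>2"
      by (simp add: power2_eq_square algebra_simps scaleR_2 flip: scaleR_scaleR)
    then have "L ((p + c *\<^sub>R q)\<^sup>2) = L (p\<^sup>2) + 2 * c * L (p * q) + c\<^sup>2 * L (q\<^sup>2)"
      by (simp add: add scale)
    then show ?thesis using pos[of "p + c *\<^sub>R q"] by simp
  qed
  show ?thesis
  proof (cases "L (q\<^sup>2) = 0")
    case True
    have "L (p * q) = 0"
    proof (rule ccontr)
      assume "L (p * q) \<noteq> 0"
      then show False
        using quad[of "- (L (p\<^sup>2) + 1) / (2 * L (p * q))"] True by (simp add: field_simps)
    qed
    then show ?thesis using True by simp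
  next
    case False
    then have q: "L (q\<^sup>2) > 0" using pos[of q] by simp
    have "0 \<le> L (q\<^sup>2) * (L (p\<^sup>2) + 2 * (- L (p * q) / L (q\<^sup>2)) * L (p * q) + (- L (p * q) / L (q\<^sup>2))\<^sup>2 * L (q\<^sup>2))"
      using quad[of "- L (p * q) / L (q\<^sup>2)"] q by (intro mult_nonneg_nonneg) auto
    also have "\<dots> = L (p\<^sup>2) * L (q\<^sup>2) - (L (p * q))\<^sup>2"
      using q by (simp add: field_simps power2_eq_square)
    finally show ?thesis by simp
  qed
qed

text \<open>A crude bound \<open>C * \<rho> ^ m\<close> on all terms improves itself to the sharp constant for the first
  term: with \<open>b m = a m / a 0\<close> the hypothesis says \<open>(b k)\<^sup>2 \<le> b (2 k)\<close> if \<open>a 0 > 0\<close>, so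
  \<open>\<bar>b 1\<bar> ^ (2 ^ j) \<le> (C / a 0) * \<rho> ^ (2 ^ j)\<close> for every \<open>j\<close>, which is impossible when
  \<open>\<bar>b 1\<bar> > \<rho>\<close>.\<close>
lemma doubling_growth_bound:
  fixes a :: "nat \<Rightarrow> real"
  assumes nonneg: "0 \<le> a 0" and cs: "\<And>k. (a k)\<^sup>2 \<le> a 0 * a (2 * k)"
    and growth: "\<And>m. \<bar>a m\<bar> \<le> C * \<rho> ^ m" and "0 < \<rho>"
  shows "\<bar>a 1\<bar> \<le> \<rho> * a 0"
proof (cases "a 0 = 0")
  case True
  with cs[of 1] show ?thesis by simp
next
  case False
  with nonneg have a0: "0 < a 0" by simp
  define b where "b k = a k / a 0" for k
  have b2: "(b k)\<^sup>2 \<le> b (2 * k)" for k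
    using cs[of k] a0 by (simp add: b_def field_simps power2_eq_square)
  have pow: "\<bar>b 1\<bar> ^ (2 ^ j) \<le> \<bar>b (2 ^ j)\<bar>" for j
  proof (induction j)
    case (Suc j)
    have "\<bar>b 1\<bar> ^ (2 ^ Suc j) = (\<bar>b 1\<bar> ^ (2 ^ j))\<^sup>2"
      by (simp add: power_mult[symmetric] mult.commute)
    also have "\<dots> \<le> \<bar>b (2 ^ j)\<bar>\<^sup>2"
      using Suc by (intro power_mono) auto
    also have "\<dots> \<le> \<bar>b (2 ^ Suc j)\<bar>"
      using b2[of "2 ^ j"] by simp
    finally show ?case .
  qed simp
  have bound: "(\<bar>b 1\<bar> / \<rho>) ^ (2 ^ j) \<le> C / a 0" for j
  proof -
    have "\<bar>b 1\<bar> ^ (2 ^ j) \<le> \<bar>a (2 ^ j)\<bar> / a 0"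
      using pow[of j] a0 by (simp add: b_def)
    also have "\<dots> \<le> C * \<rho> ^ (2 ^ j) / a 0"
      using growth a0 by (intro divide_right_mono) auto
    finally show ?thesis
      using \<open>0 < \<rho>\<close> by (simp add: field_simps power_divide)
  qed
  have "\<bar>b 1\<bar> / \<rho> \<le> 1"
  proof (rule ccontr)
    assume "\<not> \<bar>b 1\<bar> / \<rho> \<le> 1"
    then have gt: "1 < \<bar>b 1\<bar> / \<rho>" by simp
    then obtain n where n: "C / a 0 < (\<bar>b 1\<bar> / \<rho>) ^ n"
      using real_arch_pow by blast
    also have "\<dots> \<le> (\<bar>b 1\<bar> / \<rho>) ^ (2 ^ n)"
      using gt by (intro power_increasing) (auto simp: less_imp_le)
    finally show False using bound[of n] by simp
  qed
  then show ?thesis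
    using \<open>0 < \<rho>\<close> a0 by (simp add: b_def field_simps)
qed

locale positive_functional =
  fixes L :: "'n::finite mpoly \<Rightarrow> real" and \<rho> :: real
  assumes linear: "linear L"
    and unital: "L 1 = 1"
    and square_nonneg: "\<And>q. 0 \<le> L (q\<^sup>2)"
    and moment_bound: "\<And>\<alpha>. \<bar>L (monomial \<alpha>)\<bar> \<le> \<rho> ^ expo_deg \<alpha>"
    and radius_pos: "0 < \<rho>"
begin

sublocale linear L by (rule linear)

text \<open>The bound on the moments is exponential in the degree, so the shift by a fixed polynomial \<open>p\<close>
  only changes the constant.  The power of \<open>\<rho>\<close> stays the same, and this is all that
  \<open>doubling_growth_bound\<close> uses.\<close>
lemma var_power_growth: "\<exists>C. \<forall>m. \<bar>L (var_poly i ^ m * p)\<bar> \<le> C * \<rho> ^ m"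
proof (intro exI allI)
  fix m
  let ?c = "Poly_Mapping.lookup p" and ?K = "Poly_Mapping.keys p"
  have "L (var_poly i ^ m * p) = (\<Sum>\<alpha>\<in>?K. ?c \<alpha> * L (var_poly i ^ m * monomial \<alpha>))"
    unfolding linear_on_poly[OF linear_compose_mult[OF linear], of _ p] moment_functional_def ..
  also have "\<bar>\<dots>\<bar> \<le> (\<Sum>\<alpha>\<in>?K. \<bar>?c \<alpha>\<bar> * \<rho> ^ (m + expo_deg \<alpha>))"
  proof (rule order_trans[OF sum_abs], rule sum_mono)
    fix \<alpha>
    have "\<bar>L (var_poly i ^ m * monomial \<alpha>)\<bar> \<le> \<rho> ^ (m + expo_deg \<alpha>)"
      using moment_bound[of "Poly_Mapping.single i m + \<alpha>"]
      by (simp add: var_poly_power monomial_add expo_deg_add)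
    then show "\<bar>?c \<alpha> * L (var_poly i ^ m * monomial \<alpha>)\<bar> \<le> \<bar>?c \<alpha>\<bar> * \<rho> ^ (m + expo_deg \<alpha>)"
      by (simp add: abs_mult mult_left_mono)
  qed
  also have "\<dots> = (\<Sum>\<alpha>\<in>?K. \<bar>?c \<alpha>\<bar> * \<rho> ^ expo_deg \<alpha>) * \<rho> ^ m"
    by (simp add: sum_distrib_left sum_distrib_right power_add mult_ac)
  finally show "\<bar>L (var_poly i ^ m * p)\<bar> \<le> (\<Sum>\<alpha>\<in>?K. \<bar>?c \<alpha>\<bar> * \<rho> ^ expo_deg \<alpha>) * \<rho> ^ m" .
qed

text \<open>The constraint \<open>h \<ge> 0\<close> as the functional sees it: the localizing form of \<open>h\<close> is positive
  semidefinite at every order.\<close>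
definition localizes :: "'n mpoly \<Rightarrow> bool" where
  "localizes h \<longleftrightarrow> (\<forall>q. 0 \<le> L (h * q\<^sup>2))"

lemma localizes_1: "localizes 1"
  by (simp add: localizes_def square_nonneg)

lemma localizes_nonneg: "localizes h \<Longrightarrow> 0 \<le> L h"
  by (metis localizes_def mult.right_neutral power_one)

lemma localizes_scaleR: "localizes h \<Longrightarrow> 0 \<le> c \<Longrightarrow> localizes (c *\<^sub>R h)"
  by (simp add: localizes_def scale)

text \<open>The functional \<open>p \<mapsto> L (h * p)\<close> is again positive on squares, so the numbers
  \<open>a m = L (x\<^sub>i ^ m * h * q\<^sup>2)\<close> satisfy the Cauchy-Schwarz hypothesis of
  \<open>doubling_growth_bound\<close>.  Hence \<open>\<rho> + x\<^sub>i\<close> and \<open>\<rho> - x\<^sub>i\<close> may be multiplied to any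
  localizing polynomial, although a product of localizing polynomials need not localize in general.\<close>
lemma localizes_var_bound:
  assumes "localizes h"
  shows "\<bar>L (var_poly i * h * q\<^sup>2)\<bar> \<le> \<rho> * L (h * q\<^sup>2)"
proof -
  obtain C where C: "\<And>m. \<bar>L (var_poly i ^ m * (h * q\<^sup>2))\<bar> \<le> C * \<rho> ^ m"
    using var_power_growth by blast
  have "(L (var_poly i ^ k * (h * q\<^sup>2)))\<^sup>2 \<le> L (h * q\<^sup>2) * L (var_poly i ^ (2 * k) * (h * q\<^sup>2))" for k
    using positive_functional_Cauchy_Schwarz[OF linear_compose_mult[OF linear, of h],
        of q "var_poly i ^ k * q"] assms
    by (simp add: localizes_def power_mult_distrib power2_eq_square power_mult mult_ac)
  then show ?thesis
    using doubling_growth_bound[of "\<lambda>m. L (var_poly i ^ m * (h * q\<^sup>2))" C \<rho>] C radius_pos assms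
    by (simp add: localizes_def mult.assoc)
qed

text \<open>The barycentric coordinates of the interval \<open>[-\<rho>, \<rho>]\<close>; as in Bernstein approximation they
  are the building blocks of a partition of unity.\<close>

definition upper :: "'n \<Rightarrow> 'n mpoly" where
  "upper i = (1 / (2 * \<rho>)) *\<^sub>R (\<rho> *\<^sub>R 1 + var_poly i)"

definition lower :: "'n \<Rightarrow> 'n mpoly" where
  "lower i = (1 / (2 * \<rho>)) *\<^sub>R (\<rho> *\<^sub>R 1 - var_poly i)"

lemma upper_plus_lower: "upper i + lower i = 1"
  using radius_pos by (simp add: upper_def lower_def algebra_simps flip: scaleR_add_left)

lemma var_conv_upper: "var_poly i = (2 * \<rho>) *\<^sub>R upper i - \<rho> *\<^sub>R 1"
  using radius_pos by (simp add: upper_def)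

lemma localizes_upper: "localizes h \<Longrightarrow> localizes (upper i * h)"
proof -
  assume h: "localizes h"
  have "localizes (\<rho> *\<^sub>R h + var_poly i * h)"
    unfolding localizes_def
  proof
    fix q
    show "0 \<le> L ((\<rho> *\<^sub>R h + var_poly i * h) * q\<^sup>2)"
      using localizes_var_bound[OF h, of i q] by (simp add: distrib_right add scale)
  qed
  from localizes_scaleR[OF this, of "1 / (2 * \<rho>)"] radius_pos show ?thesis
    by (simp add: upper_def distrib_right)
qed

lemma localizes_lower: "localizes h \<Longrightarrow> localizes (lower i * h)"
proof -
  assume h: "localizes h"
  have "localizes (\<rho> *\<^sub>R h - var_poly i * h)"
    unfolding localizes_def
  proof
    fix q
    show "0 \<le> L ((\<rho> *\<^sub>R h - var_poly i * h) * q\<^sup>2)"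
      using localizes_var_bound[OF h, of i q] by (simp add: left_diff_distrib diff scale)
  qed
  from localizes_scaleR[OF this, of "1 / (2 * \<rho>)"] radius_pos show ?thesis
    by (simp add: lower_def left_diff_distrib)
qed

definition bernstein :: "nat \<Rightarrow> nat \<Rightarrow> 'n \<Rightarrow> 'n mpoly" where
  "bernstein N j i = of_nat (N choose j) * upper i ^ j * lower i ^ (N - j)"

lemma localizes_bernstein: "localizes h \<Longrightarrow> localizes (bernstein N j i * h)"
proof -
  assume h: "localizes h"
  have l: "localizes (lower i ^ k * h)" for k
    by (induction k) (simp_all add: h localizes_lower mult.assoc)
  have u: "localizes (upper i ^ m * (lower i ^ k * h))" for k m
    by (induction m) (simp_all add: l localizes_upper mult.assoc)
  have "bernstein N j i * h = real (N choose j) *\<^sub>R (upper i ^ j * (lower i ^ (N - j) * h))"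
    by (simp add: bernstein_def scaleR_conv_of_real mult.assoc)
  with localizes_scaleR[OF u] show ?thesis by simp
qed

text \<open>These values are the weights that \<open>L\<close> gives to the points of a grid in the box.\<close>
lemma bernstein_prod_nonneg: "0 \<le> L (\<Prod>i\<in>I. bernstein N (J i) i)"
proof (rule localizes_nonneg)
  show "localizes (\<Prod>i\<in>I. bernstein N (J i) i)"
    by (induction I rule: infinite_finite_induct) (simp_all add: localizes_1 localizes_bernstein)
qed

text \<open>Multiplying \<open>upper i ^ k\<close> by \<open>(upper i + lower i) ^ (N - k) = 1\<close> gives an exact expansion in
  the Bernstein basis, with coefficients close to \<open>(j / N) ^ k\<close>.  Using these coefficients in place
  of \<open>(j / N) ^ k\<close> avoids any error estimate between a polynomial and its Bernstein approximation.\<close>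

lemma upper_power_bernstein:
  assumes "k \<le> N"
  shows "upper i ^ k = (\<Sum>j\<le>N. (real (j choose k) / real (N choose k)) *\<^sub>R bernstein N j i)"
proof -
  have pos: "0 < N choose k" using assms by simp
  have "upper i ^ k = upper i ^ k * (upper i + lower i) ^ (N - k)"
    by (simp add: upper_plus_lower)
  also have "\<dots> = (\<Sum>l\<le>N - k. of_nat ((N - k) choose l) * upper i ^ (k + l) * lower i ^ (N - k - l))"
    by (simp add: binomial_ring sum_distrib_left power_add mult_ac)
  also have "\<dots> = (\<Sum>j\<in>{k..N}. of_nat ((N - k) choose (j - k)) * upper i ^ j * lower i ^ (N - j))"
    by (rule sum.reindex_bij_witness[of _ "\<lambda>j. j - k" "\<lambda>l. k + l"]) (use assms in auto)
  also have "\<dots> = (\<Sum>j\<in>{k..N}. (real (j choose k) / real (N choose k)) *\<^sub>R bernstein N j i)"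
  proof (rule sum.cong[OF refl])
    fix j assume j: "j \<in> {k..N}"
    then have "(N choose j) * (j choose k) = (N choose k) * ((N - k) choose (j - k))"
      by (intro choose_mult) auto
    then have "real (j choose k) / real (N choose k) * real (N choose j) = real ((N - k) choose (j - k))"
      using pos by (simp add: field_simps flip: of_nat_mult)
    then have "of_real (real (j choose k) / real (N choose k)) * (of_nat (N choose j) :: 'n mpoly)
        = of_nat ((N - k) choose (j - k))"
      by (metis of_real_mult of_real_of_nat_eq)
    then show "of_nat ((N - k) choose (j - k)) * upper i ^ j * lower i ^ (N - j)
        = (real (j choose k) / real (N choose k)) *\<^sub>R bernstein N j i"
      by (simp only: bernstein_def scaleR_conv_of_real mult.assoc[symmetric])
  qed
  also have "\<dots> = (\<Sum>j\<le>N. (real (j choose k) / real (N choose k)) *\<^sub>R bernstein N j i)"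
    by (rule sum.mono_neutral_left) (auto simp: binomial_eq_0 not_le)
  finally show ?thesis .
qed

text \<open>The coefficient of \<open>bernstein N j i\<close> in \<open>x\<^sub>i ^ m\<close>, obtained from the binomial expansion of
  \<open>x\<^sub>i ^ m = (2 \<rho> upper i - \<rho>) ^ m\<close>.  For \<open>j / N\<close> near \<open>s\<close> it is near \<open>(2 \<rho> s - \<rho>) ^ m\<close>, the
  value of \<open>x\<^sub>i ^ m\<close> at the corresponding grid point.\<close>
definition bernstein_coeff :: "nat \<Rightarrow> nat \<Rightarrow> nat \<Rightarrow> real" where
  "bernstein_coeff N m j = (\<Sum>k\<le>m. real (m choose k) * (2 * \<rho>) ^ k * (- \<rho>) ^ (m - k) *
     (real (j choose k) / real (N choose k)))"

lemma var_power_bernstein: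
  assumes "m \<le> N"
  shows "var_poly i ^ m = (\<Sum>j\<le>N. bernstein_coeff N m j *\<^sub>R bernstein N j i)"
proof -
  have "var_poly i ^ m = ((2 * \<rho>) *\<^sub>R upper i + of_real (- \<rho>)) ^ m"
    by (simp add: var_conv_upper[of i] scaleR_conv_of_real)
  also have "\<dots> = (\<Sum>k\<le>m. of_nat (m choose k) * ((2 * \<rho>) *\<^sub>R upper i) ^ k * of_real (- \<rho>) ^ (m - k))"
    by (rule binomial_ring)
  also have "\<dots> = (\<Sum>k\<le>m. (real (m choose k) * (2 * \<rho>) ^ k * (- \<rho>) ^ (m - k)) *\<^sub>R upper i ^ k)"
  proof (rule sum.cong[OF refl])
    fix k
    show "of_nat (m choose k) * ((2 * \<rho>) *\<^sub>R upper i) ^ k * of_real (- \<rho>) ^ (m - k) =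
        (real (m choose k) * (2 * \<rho>) ^ k * (- \<rho>) ^ (m - k)) *\<^sub>R upper i ^ k"
      by (simp only: scaleR_conv_of_real of_real_mult of_real_power of_real_of_nat_eq power_mult_distrib mult_ac)
  qed
  also have "\<dots> = (\<Sum>k\<le>m. \<Sum>j\<le>N. (real (m choose k) * (2 * \<rho>) ^ k * (- \<rho>) ^ (m - k) *
     (real (j choose k) / real (N choose k))) *\<^sub>R bernstein N j i)"
    by (intro sum.cong[OF refl]) (use assms in \<open>simp add: upper_power_bernstein[of _ N] scaleR_sum_right\<close>)
  also have "\<dots> = (\<Sum>j\<le>N. bernstein_coeff N m j *\<^sub>R bernstein N j i)"
    by (subst sum.swap) (simp add: bernstein_coeff_def scaleR_sum_left)
  finally show ?thesis .
qed

end

section \<open>Comparison with point values\<close>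

text \<open>The quotient is \<open>\<Prod>i<k. (j - i) / (N - i)\<close>, and each of its \<open>k\<close> factors tends to \<open>s\<close>.\<close>
lemma binomial_quotient_tendsto:
  fixes j N :: "nat \<Rightarrow> nat"
  assumes N: "filterlim N at_top sequentially"
    and lim: "(\<lambda>n. real (j n) / real (N n)) \<longlonglongrightarrow> s"
  shows "(\<lambda>n. real (j n choose k) / real (N n choose k)) \<longlonglongrightarrow> s ^ k"
proof -
  have inv: "(\<lambda>n. c / real (N n)) \<longlonglongrightarrow> 0" for c :: real
    by (rule tendsto_divide_0[OF tendsto_const])
       (use filterlim_compose[OF filterlim_real_sequentially N] in \<open>rule filterlim_at_top_imp_at_infinity\<close>)
  have "(\<lambda>n. (real (j n) / real (N n) - real i / real (N n)) / (1 - real i / real (N n)))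
      \<longlonglongrightarrow> (s - 0) / (1 - 0)" for i
    by (intro tendsto_intros lim inv) simp
  then have "(\<lambda>n. \<Prod>i<k. (real (j n) / real (N n) - real i / real (N n)) / (1 - real i / real (N n)))
      \<longlonglongrightarrow> (\<Prod>i<k. (s - 0) / (1 - 0))"
    by (intro tendsto_prod)
  moreover have "\<forall>\<^sub>F n in sequentially.
      (\<Prod>i<k. (real (j n) / real (N n) - real i / real (N n)) / (1 - real i / real (N n)))
      = real (j n choose k) / real (N n choose k)"
    using eventually_compose_filterlim[OF eventually_gt_at_top[of 0] N]
  proof eventually_elim
    case (elim n)
    have "(\<Prod>i<k. (real (j n) / real (N n) - real i / real (N n)) / (1 - real i / real (N n)))
        = (\<Prod>i<k. (real (j n) - real i) / (real (N n) - real i))"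
      using elim by (intro prod.cong refl) (simp add: diff_divide_distrib[symmetric] divide_simps)
    then show ?case
      by (simp add: binomial_gbinomial gbinomial_prod_rev prod_dividef lessThan_atLeast0)
  qed
  ultimately show ?thesis
    by (auto simp: tendsto_cong)
qed

context positive_functional
begin

lemma monomial_bernstein:
  assumes "\<And>i. Poly_Mapping.lookup \<alpha> i \<le> N"
  shows "monomial \<alpha> = (\<Sum>J\<in>Pi\<^sub>E UNIV (\<lambda>_. {..N}).
     (\<Prod>i\<in>UNIV. bernstein_coeff N (Poly_Mapping.lookup \<alpha> i) (J i)) *\<^sub>R (\<Prod>i\<in>UNIV. bernstein N (J i) i))"
proof -
  have "monomial \<alpha> = (\<Prod>i\<in>UNIV. \<Sum>j\<le>N. bernstein_coeff N (Poly_Mapping.lookup \<alpha> i) j *\<^sub>R bernstein N j i)"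
    unfolding monomial_conv_prod by (intro prod.cong refl var_power_bernstein assms)
  also have "\<dots> = (\<Sum>J\<in>Pi\<^sub>E UNIV (\<lambda>_. {..N}). \<Prod>i\<in>UNIV.
      bernstein_coeff N (Poly_Mapping.lookup \<alpha> i) (J i) *\<^sub>R bernstein N (J i) i)"
    by (rule prod_sum_PiE) auto
  finally show ?thesis
    by (simp add: scaleR_conv_of_real prod.distrib)
qed

text \<open>The coefficient of \<open>p\<close> at the grid index \<open>J\<close> in the multivariate Bernstein basis.\<close>
definition bernstein_value :: "nat \<Rightarrow> 'n mpoly \<Rightarrow> ('n \<Rightarrow> nat) \<Rightarrow> real" where
  "bernstein_value N p J = (\<Sum>\<alpha>\<in>Poly_Mapping.keys p. Poly_Mapping.lookup p \<alpha> *
     (\<Prod>i\<in>UNIV. bernstein_coeff N (Poly_Mapping.lookup \<alpha> i) (J i)))"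

lemma functional_bernstein:
  assumes "total_deg p \<le> N"
  shows "L p = (\<Sum>J\<in>Pi\<^sub>E UNIV (\<lambda>_. {..N}). bernstein_value N p J * L (\<Prod>i\<in>UNIV. bernstein N (J i) i))"
proof -
  let ?D = "Pi\<^sub>E UNIV (\<lambda>_. {..N}) :: ('n \<Rightarrow> nat) set"
  have le: "Poly_Mapping.lookup \<alpha> i \<le> N" if "\<alpha> \<in> Poly_Mapping.keys p" for \<alpha> and i :: 'n
  proof -
    have "Poly_Mapping.lookup \<alpha> i \<le> expo_deg \<alpha>"
      unfolding expo_deg_def by (rule member_le_sum) auto
    then show ?thesis
      using assms that unfolding total_deg_le_iff expos_def by force
  qed
  have "L p = (\<Sum>\<alpha>\<in>Poly_Mapping.keys p. Poly_Mapping.lookup p \<alpha> * L (monomial \<alpha>))"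
    unfolding linear_on_poly[OF linear, of p] moment_functional_def ..
  also have "\<dots> = (\<Sum>\<alpha>\<in>Poly_Mapping.keys p. \<Sum>J\<in>?D. Poly_Mapping.lookup p \<alpha> *
     (\<Prod>i\<in>UNIV. bernstein_coeff N (Poly_Mapping.lookup \<alpha> i) (J i)) * L (\<Prod>i\<in>UNIV. bernstein N (J i) i))"
  proof (rule sum.cong[OF refl])
    fix \<alpha> assume "\<alpha> \<in> Poly_Mapping.keys p"
    then show "Poly_Mapping.lookup p \<alpha> * L (monomial \<alpha>) = (\<Sum>J\<in>?D. Poly_Mapping.lookup p \<alpha> *
       (\<Prod>i\<in>UNIV. bernstein_coeff N (Poly_Mapping.lookup \<alpha> i) (J i)) * L (\<Prod>i\<in>UNIV. bernstein N (J i) i))"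
      by (subst monomial_bernstein[OF le]) (simp_all add: sum scale sum_distrib_left mult.assoc)
  qed
  also have "\<dots> = (\<Sum>J\<in>?D. bernstein_value N p J * L (\<Prod>i\<in>UNIV. bernstein N (J i) i))"
    by (subst sum.swap) (simp add: bernstein_value_def sum_distrib_right)
  finally show ?thesis .
qed

text \<open>\<open>L p\<close> is a convex combination of the Bernstein coefficients of \<open>p\<close>: the weights are
  nonnegative, and their sum is \<open>L 1\<close> because all coefficients of the polynomial \<open>1\<close> are \<open>1\<close>.  So some
  coefficient is at most \<open>L p\<close>.\<close>
lemma bernstein_value_le:
  assumes "total_deg p \<le> N"
  shows "\<exists>J. (\<forall>i. J i \<le> N) \<and> bernstein_value N p J \<le> L p"
proof (rule ccontr)
  assume neg: "\<not> ?thesis"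
  let ?D = "Pi\<^sub>E UNIV (\<lambda>_. {..N}) :: ('n \<Rightarrow> nat) set"
  define w where "w J = L (\<Prod>i\<in>UNIV. bernstein N (J i) i)" for J
  have "1 = (\<Sum>J\<in>?D. bernstein_value N 1 J * w J)"
    using functional_bernstein[of 1 N] unital by (simp add: total_deg_def w_def)
  moreover have "bernstein_value N 1 J = 1" for J
    by (simp add: bernstein_value_def bernstein_coeff_def)
  ultimately have w1: "(\<Sum>J\<in>?D. w J) = 1" by simp
  have w0: "0 \<le> w J" for J
    unfolding w_def by (rule bernstein_prod_nonneg)
  have gt: "L p < bernstein_value N p J" if "J \<in> ?D" for J
  proof -
    have "\<forall>i. J i \<le> N" using that by auto
    with neg show ?thesis by (meson not_le)
  qed
  have sum0: "(\<Sum>J\<in>?D. (bernstein_value N p J - L p) * w J) = 0"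
    using functional_bernstein[OF assms] w1
    by (simp add: left_diff_distrib sum_subtractf w_def flip: sum_distrib_left)
  have zero: "\<forall>J\<in>?D. (bernstein_value N p J - L p) * w J = 0"
    using sum0
  proof (subst (asm) sum_nonneg_eq_0_iff)
    show "finite ?D" by (simp add: finite_PiE)
    show "0 \<le> (bernstein_value N p J - L p) * w J" if "J \<in> ?D" for J
      using gt[OF that] w0[of J] by simp
  qed
  have "(\<Sum>J\<in>?D. w J) = 0"
  proof (intro sum.neutral ballI)
    fix J assume J: "J \<in> ?D"
    from zero J have "(bernstein_value N p J - L p) * w J = 0" by (rule bspec)
    with gt[OF J] show "w J = 0" by simp
  qed
  with w1 show False by simp
qed

definition moment_box :: "(real ^ 'n) set" where
  "moment_box = cbox (\<chi> i. - \<rho>) (\<chi> i. \<rho>)"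

lemma compact_moment_box: "compact moment_box"
  by (simp add: moment_box_def)

text \<open>A positive functional with bounded moments behaves like the mean over a probability measure on
  the box: no value \<open>L p\<close> lies below all the values of \<open>p\<close>.  The point is a limit of grid points
  \<open>J / N\<close> whose Bernstein coefficient is at most \<open>L p\<close>; along a convergent subsequence these
  coefficients tend to the value of \<open>p\<close> at the limit.\<close>
theorem exists_point_value_le: "\<exists>x\<in>moment_box. poly_eval p x \<le> L p"
proof -
  define N where "N n = n + total_deg p + 1" for n
  have "\<exists>J. (\<forall>i. J i \<le> N n) \<and> bernstein_value (N n) p J \<le> L p" for n
    by (rule bernstein_value_le) (simp add: N_def)
  then obtain J where J: "\<And>n i. J n i \<le> N n" "\<And>n. bernstein_value (N n) p (J n) \<le> L p"
    by metis
  define s :: "nat \<Rightarrow> real ^ 'n" where "s n = (\<chi> i. real (J n i) / real (N n))" for n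
  have "real (J n i) / real (N n) \<le> 1" for n i
    using J(1)[of n i] by (simp add: divide_le_eq_1 N_def)
  then have "s n \<in> cbox 0 1" for n
    by (simp add: s_def mem_box_cart)
  moreover have "seq_compact (cbox 0 1 :: (real ^ 'n) set)"
    by (simp add: compact_eq_seq_compact_metric[symmetric])
  ultimately obtain l r where l: "l \<in> cbox 0 1" and r: "strict_mono r" and lim: "(s \<circ> r) \<longlonglongrightarrow> l"
    unfolding seq_compact_def by blast
  \<comment> \<open>The grid lives in the unit cube, and the box \<open>[-\<rho>, \<rho>]\<close> is its affine image.\<close>
  define x where "x = (\<chi> i. 2 * \<rho> * l $ i - \<rho>)"
  have "filterlim N at_top sequentially"
    by (rule filterlim_subseq) (simp add: strict_mono_def N_def)
  then have N: "filterlim (\<lambda>n. N (r n)) at_top sequentially"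
    by (rule filterlim_compose[OF _ filterlim_subseq[OF r]])
  have quot: "(\<lambda>n. real (J (r n) i) / real (N (r n))) \<longlonglongrightarrow> l $ i" for i
    using tendsto_vec_nth[OF lim, of i] by (simp add: s_def)
  have "(\<lambda>n. bernstein_coeff (N (r n)) m (J (r n) i)) \<longlonglongrightarrow> (x $ i) ^ m" for m i
  proof -
    have "(\<lambda>n. bernstein_coeff (N (r n)) m (J (r n) i)) \<longlonglongrightarrow>
        (\<Sum>k\<le>m. real (m choose k) * (2 * \<rho>) ^ k * (- \<rho>) ^ (m - k) * (l $ i) ^ k)"
      unfolding bernstein_coeff_def
      by (intro tendsto_intros binomial_quotient_tendsto N quot)
    also have "(\<Sum>k\<le>m. real (m choose k) * (2 * \<rho>) ^ k * (- \<rho>) ^ (m - k) * (l $ i) ^ k) = (x $ i) ^ m"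
      using binomial_ring[of "2 * \<rho> * l $ i" "- \<rho>" m] by (simp add: x_def power_mult_distrib mult_ac)
    finally show ?thesis .
  qed
  then have "(\<lambda>n. bernstein_value (N (r n)) p (J (r n))) \<longlonglongrightarrow> poly_eval p x"
    unfolding bernstein_value_def poly_eval_def mon_eval_def by (intro tendsto_intros)
  then have "poly_eval p x \<le> L p"
    by (rule tendsto_upperbound) (use J(2) in auto)
  moreover have "x \<in> moment_box"
  proof -
    have "0 \<le> l $ i \<and> l $ i \<le> 1" for i
      using l by (simp add: mem_box_cart)
    then have "\<rho> * 0 \<le> \<rho> * l $ i \<and> \<rho> * l $ i \<le> \<rho> * 1" for i
      using radius_pos by (intro conjI mult_left_mono) auto
    then show ?thesis
      by (auto simp: moment_box_def mem_box_cart x_def)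
  qed
  ultimately show ?thesis by blast
qed

end

section \<open>Positivity on the feasible set and on the minimizers\<close>

text \<open>The sum of the positive parts is continuous and positive, so it has a positive minimum on the
  compact set; at each point some member of \<open>F\<close> takes at least the share \<open>1 / card F\<close> of it.\<close>
lemma uniformly_positive_on_compact:
  assumes "finite F" and "compact B" and pos: "\<And>x. x \<in> B \<Longrightarrow> \<exists>q\<in>F. 0 < poly_eval q x"
  shows "\<exists>\<epsilon>>0. \<forall>x\<in>B. \<exists>q\<in>F. \<epsilon> \<le> poly_eval q x"
proof (cases "B = {}")
  case False
  define \<Phi> where "\<Phi> x = (\<Sum>q\<in>F. max 0 (poly_eval q x))" for x
  have "continuous_on B \<Phi>"
    unfolding \<Phi>_def by (intro continuous_intros)
  from continuous_attains_inf[OF \<open>compact B\<close> False this]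
  obtain x0 where x0: "x0 \<in> B" "\<And>x. x \<in> B \<Longrightarrow> \<Phi> x0 \<le> \<Phi> x" by blast
  have card: "0 < card F"
    using pos[OF x0(1)] \<open>finite F\<close> by (auto simp: card_gt_0_iff)
  have "0 < \<Phi> x0"
  proof -
    obtain q where q: "q \<in> F" "0 < poly_eval q x0" using pos x0(1) by blast
    then have "max 0 (poly_eval q x0) \<le> \<Phi> x0"
      unfolding \<Phi>_def by (intro member_le_sum) (auto simp: \<open>finite F\<close>)
    with q show ?thesis by simp
  qed
  show ?thesis
  proof (intro exI[of _ "\<Phi> x0 / card F"] conjI ballI)
    show "0 < \<Phi> x0 / card F" using \<open>0 < \<Phi> x0\<close> card by simp
    fix x assume "x \<in> B"
    show "\<exists>q\<in>F. \<Phi> x0 / card F \<le> poly_eval q x"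
    proof (rule ccontr)
      assume "\<not> ?thesis"
      then have less: "poly_eval q x < \<Phi> x0 / card F" if "q \<in> F" for q
        using that by (auto simp: not_le)
      have "max 0 (poly_eval q x) < \<Phi> x0 / card F" if "q \<in> F" for q
        using less[OF that] \<open>0 < \<Phi> x0\<close> card by simp
      then have "\<Phi> x < (\<Sum>q\<in>F. \<Phi> x0 / card F)"
        unfolding \<Phi>_def[of x] using card \<open>finite F\<close> by (intro sum_strict_mono) auto
      also have "\<dots> = \<Phi> x0" using card by simp
      also have "\<dots> \<le> \<Phi> x" using x0 \<open>x \<in> B\<close> by blast
      finally show False by simp
    qed
  qed
qed (auto intro: exI[of _ 1])

lemma uniformly_bounded_on_compact:
  assumes "finite F" and "compact B"
  shows "\<exists>M>0. \<forall>q\<in>F. \<forall>x\<in>B. \<bar>poly_eval q x\<bar> \<le> M"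
proof -
  have "bounded (\<Union>q\<in>F. poly_eval q ` B)"
    using assms by (intro bounded_UN ballI compact_imp_bounded compact_continuous_image continuous_on_poly_eval)
  then show ?thesis
    by (auto simp: bounded_pos)
qed

text \<open>For \<open>s \<in> [0, 1]\<close> this is Bernoulli's inequality:
  \<open>(1 - s) ^ n * (1 + n s) \<le> (1 - s\<^sup>2) ^ n \<le> 1\<close>.  Together with \<open>s * (1 - s) ^ n \<le> s\<close> for negative
  \<open>s\<close> it says that \<open>- s * (1 - s) ^ n\<close> acts as a penalty for \<open>s < 0\<close> and almost vanishes for
  \<open>s \<ge> 0\<close>.\<close>
lemma times_one_minus_power_le:
  fixes s :: real
  assumes "s \<le> 1" "even n" "0 < n"
  shows "s * (1 - s) ^ n \<le> 1 / n"
proof (cases "0 \<le> s")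
  case True
  have "(1 - s) ^ n * (1 + n * s) \<le> (1 - s) ^ n * (1 + s) ^ n"
    using assms True by (intro mult_left_mono Bernoulli_inequality) auto
  also have "\<dots> = (1 - s\<^sup>2) ^ n"
    by (simp add: power2_eq_square algebra_simps flip: power_mult_distrib)
  also have "\<dots> \<le> 1"
    using assms True by (intro power_le_one) (auto simp: power_le_one)
  finally have "(1 - s) ^ n * (1 + n * s) \<le> 1" .
  moreover have "n * (s * (1 - s) ^ n) \<le> (1 - s) ^ n * (1 + n * s)"
    using assms by (simp add: algebra_simps zero_le_even_power)
  ultimately have "s * (1 - s) ^ n * n \<le> 1"
    by (simp add: mult_ac)
  then show ?thesis
    using assms by (simp add: pos_le_divide_eq)
next
  case False
  then have "s * (1 - s) ^ n \<le> 0"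
    using assms by (simp add: mult_nonpos_nonneg zero_le_even_power)
  also have "0 \<le> 1 / real n" by simp
  finally show ?thesis .
qed

context positive_functional
begin

text \<open>This is the part of Putinar's Positivstellensatz that concerns a single functional.  With each
  \<open>h \<in> G\<close> scaled to \<open>s = h / M \<in> [-1, 1]\<close> on the box, the polynomial
  \<open>P = p - \<kappa> * (\<Sum>h\<in>G. s * (1 - s) ^ (2 N))\<close> is nonnegative on the whole box for suitable \<open>\<kappa>\<close> and
  \<open>N\<close>: at points where \<open>p\<close> is at least \<open>\<epsilon>\<close> the subtracted terms are small, and elsewhere some
  constraint is violated by at least \<open>\<epsilon>\<close> and its penalty outweighs \<open>p\<close>.  Then \<open>0 \<le> L P\<close> because
  \<open>P\<close> takes a value of at most \<open>L P\<close> on the box, and \<open>L p\<close> exceeds \<open>L P\<close> by values of \<open>L\<close> at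
  localizing polynomials times squares.\<close>
theorem nonneg_if_positive_on_feasible:
  assumes "finite G" and loc: "\<And>h. h \<in> G \<Longrightarrow> localizes h"
    and pos: "\<And>x. x \<in> moment_box \<Longrightarrow> \<forall>h\<in>G. 0 \<le> poly_eval h x \<Longrightarrow> 0 < poly_eval p x"
  shows "0 \<le> L p"
proof -
  have neg: "poly_eval (- q) x = - poly_eval q x" for q :: "'n mpoly" and x
    using poly_eval_diff[of 0 q x] by simp
  have "\<exists>q\<in>insert p (uminus ` G). 0 < poly_eval q x" if "x \<in> moment_box" for x
    by (cases "\<forall>h\<in>G. 0 \<le> poly_eval h x") (use pos[OF that] in \<open>auto simp: neg not_le\<close>)
  from uniformly_positive_on_compact[OF _ compact_moment_box this] \<open>finite G\<close>
  obtain \<epsilon> where \<epsilon>: "0 < \<epsilon>"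
    and alt: "\<And>x. x \<in> moment_box \<Longrightarrow> \<epsilon> \<le> poly_eval p x \<or> (\<exists>h\<in>G. poly_eval h x \<le> - \<epsilon>)"
    by (fastforce simp: neg)
  obtain M where M: "0 < M" and bound: "\<And>q x. q \<in> insert p G \<Longrightarrow> x \<in> moment_box \<Longrightarrow> \<bar>poly_eval q x\<bar> \<le> M"
    using uniformly_bounded_on_compact[of "insert p G", OF _ compact_moment_box] \<open>finite G\<close> by auto
  \<comment> \<open>Then \<open>\<kappa> * (\<epsilon> / M) = M + \<epsilon>\<close>: one full penalty lifts \<open>p \<ge> - M\<close> to at least \<open>\<epsilon>\<close>.\<close>
  define \<kappa> where "\<kappa> = (M + \<epsilon>) / (\<epsilon> / M)"
  have \<kappa>: "0 < \<kappa>" using \<epsilon> M by (simp add: \<kappa>_def)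
  \<comment> \<open>\<open>N\<close> is so large that the terms of the satisfied constraints add up to less than \<open>\<epsilon>\<close>.\<close>
  obtain N :: nat where N: "\<kappa> * card G / \<epsilon> < N" using reals_Archimedean2 by blast
  have "0 \<le> \<kappa> * card G / \<epsilon>" using \<kappa> \<epsilon> by simp
  with N have N0: "0 < N" by linarith
  define s where "s h = (1 / M) *\<^sub>R h" for h :: "'n mpoly"
  define P where "P = p - \<kappa> *\<^sub>R (\<Sum>h\<in>G. s h * (1 - s h) ^ (2 * N))"
  define T where "T h x = poly_eval h x / M * (1 - poly_eval h x / M) ^ (2 * N)" for h :: "'n mpoly" and x
  have P_eval: "poly_eval P x = poly_eval p x - \<kappa> * (\<Sum>h\<in>G. T h x)" for x
    by (simp add: P_def s_def T_def)
  have T_le: "T h x \<le> 1 / real (2 * N)" if "h \<in> G" "x \<in> moment_box" for h x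
    unfolding T_def by (rule times_one_minus_power_le) (use bound[of h x] that M N0 in auto)
  have small: "\<kappa> * (card G * (1 / real (2 * N))) < \<epsilon>"
  proof -
    have "\<kappa> * card G < N * \<epsilon>" using N \<epsilon> by (simp add: field_simps)
    moreover have "0 < N * \<epsilon>" using N0 \<epsilon> by simp
    moreover have "\<epsilon> * real (2 * N) = N * \<epsilon> + N * \<epsilon>" by simp
    ultimately have "\<kappa> * card G < \<epsilon> * real (2 * N)" by linarith
    then have "\<kappa> * card G / real (2 * N) < \<epsilon>" using N0 by (simp add: pos_divide_less_eq)
    then show ?thesis by simp
  qed
  have "0 \<le> poly_eval P x" if x: "x \<in> moment_box" for x
    using alt[OF x]
  proof
    assume "\<epsilon> \<le> poly_eval p x"
    moreover have "(\<Sum>h\<in>G. T h x) \<le> card G * (1 / real (2 * N))"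
      by (rule sum_bounded_above) (rule T_le[OF _ x])
    then have "\<kappa> * (\<Sum>h\<in>G. T h x) \<le> \<kappa> * (card G * (1 / real (2 * N)))"
      using \<kappa> by (intro mult_left_mono) auto
    ultimately show ?thesis using small by (simp add: P_eval)
  next
    assume "\<exists>h\<in>G. poly_eval h x \<le> - \<epsilon>"
    then obtain h where h: "h \<in> G" "poly_eval h x \<le> - \<epsilon>" by blast
    define u where "u = - poly_eval h x / M"
    have u: "\<epsilon> / M \<le> u" unfolding u_def using h M by (intro divide_right_mono) auto
    have "0 < \<epsilon> / M" using \<epsilon> M by simp
    with u have u0: "0 < u" by linarith
    have "u * 1 \<le> u * (1 + u) ^ (2 * N)"
      using u0 by (intro mult_left_mono one_le_power) auto
    moreover have "T h x = - (u * (1 + u) ^ (2 * N))"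
      by (simp add: T_def u_def)
    ultimately have Th: "T h x \<le> - (\<epsilon> / M)"
      using u by linarith
    have "(\<Sum>h\<in>G. T h x) = T h x + (\<Sum>h\<in>G - {h}. T h x)"
      using h \<open>finite G\<close> by (simp add: sum.remove)
    moreover have "(\<Sum>h\<in>G - {h}. T h x) \<le> card (G - {h}) * (1 / real (2 * N))"
      by (rule sum_bounded_above) (use T_le[OF _ x] in auto)
    moreover have "card (G - {h}) * (1 / real (2 * N)) \<le> card G * (1 / real (2 * N))"
      by (intro mult_right_mono) (auto intro: card_Diff1_le)
    ultimately have "(\<Sum>h\<in>G. T h x) \<le> - (\<epsilon> / M) + card G * (1 / real (2 * N))"
      using Th by linarith
    then have "\<kappa> * (\<Sum>h\<in>G. T h x) \<le> \<kappa> * (- (\<epsilon> / M) + card G * (1 / real (2 * N)))"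
      using \<kappa> by (intro mult_left_mono) auto
    also have "\<dots> = - (\<kappa> * (\<epsilon> / M)) + \<kappa> * (card G * (1 / real (2 * N)))"
      by (simp only: distrib_left mult_minus_right)
    also have "\<kappa> * (\<epsilon> / M) = M + \<epsilon>"
      using \<epsilon> M by (simp add: \<kappa>_def)
    finally have "\<kappa> * (\<Sum>h\<in>G. T h x) \<le> - (M + \<epsilon>) + \<kappa> * (card G * (1 / real (2 * N)))" .
    moreover have "- M \<le> poly_eval p x"
      using bound[of p x] x by (simp add: abs_le_iff)
    ultimately show ?thesis
      using small unfolding P_eval by linarith
  qed
  moreover obtain x where "x \<in> moment_box" "poly_eval P x \<le> L P"
    using exists_point_value_le by blast
  ultimately have "0 \<le> L P"
    by (meson order_trans)
  moreover have "L P = L p - \<kappa> * (\<Sum>h\<in>G. L (s h * (1 - s h) ^ (2 * N)))"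
    by (simp only: P_def diff scale sum real_scaleR_def)
  moreover have "0 \<le> \<kappa> * (\<Sum>h\<in>G. L (s h * (1 - s h) ^ (2 * N)))"
  proof (intro mult_nonneg_nonneg sum_nonneg)
    fix h assume "h \<in> G"
    then have "localizes (s h)"
      unfolding s_def using loc M by (intro localizes_scaleR) auto
    then show "0 \<le> L (s h * (1 - s h) ^ (2 * N))"
      by (simp add: localizes_def power_even_eq)
  qed (use \<kappa> in simp)
  ultimately show ?thesis
    by linarith
qed

text \<open>The polynomial \<open>f - c\<close> is nonnegative on the feasible set but not positive under \<open>L\<close>, so a large
  multiple of it may be added to \<open>p + \<delta>\<close> without increasing the value of \<open>L\<close>.  It makes
  \<open>p + \<delta>\<close> positive away from the minimizers, and near them \<open>p + \<delta>\<close> is positive already.  So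
  \<open>nonneg_if_positive_on_feasible\<close> gives \<open>0 \<le> L p + \<delta>\<close>.\<close>
theorem nonneg_if_nonneg_on_minimizers:
  assumes "finite G" and loc: "\<And>h. h \<in> G \<Longrightarrow> localizes h"
    and min: "\<And>x. \<forall>h\<in>G. 0 \<le> poly_eval h x \<Longrightarrow> c \<le> poly_eval f x"
    and opt: "L f \<le> c"
    and p: "\<And>x. \<forall>h\<in>G. 0 \<le> poly_eval h x \<Longrightarrow> poly_eval f x = c \<Longrightarrow> 0 \<le> poly_eval p x"
  shows "0 \<le> L p"
proof (rule field_le_epsilon)
  fix \<delta> :: real assume "0 < \<delta>"
  define q where "q = p + \<delta> *\<^sub>R 1"
  define d where "d = f - c *\<^sub>R 1"
  let ?K = "{x \<in> moment_box. \<forall>h\<in>G. 0 \<le> poly_eval h x}"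
  have "?K = moment_box \<inter> (\<Inter>h\<in>G. {x. 0 \<le> poly_eval h x})" by auto
  also have "compact \<dots>"
    by (intro compact_Int_closed compact_moment_box closed_INT ballI closed_Collect_le
        continuous_on_const continuous_on_poly_eval)
  finally have K: "compact ?K" .
  have "\<exists>r\<in>{q, d}. 0 < poly_eval r x" if "x \<in> ?K" for x
    using that min[of x] p[of x] \<open>0 < \<delta>\<close> by (force simp: q_def d_def)
  from uniformly_positive_on_compact[OF _ K this]
  obtain \<epsilon> where \<epsilon>: "0 < \<epsilon>" "\<And>x. x \<in> ?K \<Longrightarrow> \<epsilon> \<le> poly_eval q x \<or> \<epsilon> \<le> poly_eval d x"
    by auto
  obtain M where M: "0 < M" "\<And>x. x \<in> ?K \<Longrightarrow> \<bar>poly_eval q x\<bar> \<le> M"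
    using uniformly_bounded_on_compact[of "{q}", OF _ K] by auto
  define \<kappa> where "\<kappa> = (M + 1) / \<epsilon>"
  have \<kappa>: "0 < \<kappa>" using \<epsilon> M by (simp add: \<kappa>_def)
  have "0 \<le> L (q + \<kappa> *\<^sub>R d)"
  proof (rule nonneg_if_positive_on_feasible[OF \<open>finite G\<close> loc])
    fix x assume x: "x \<in> moment_box" "\<forall>h\<in>G. 0 \<le> poly_eval h x"
    then have xK: "x \<in> ?K" by simp
    have d0: "0 \<le> poly_eval d x" using min x by (simp add: d_def)
    from \<epsilon>(2)[OF xK] show "0 < poly_eval (q + \<kappa> *\<^sub>R d) x"
    proof
      assume "\<epsilon> \<le> poly_eval q x"
      then show ?thesis using \<epsilon> \<kappa> d0 by (simp add: add_pos_nonneg)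
    next
      assume "\<epsilon> \<le> poly_eval d x"
      then have "\<kappa> * \<epsilon> \<le> \<kappa> * poly_eval d x" using \<kappa> by simp
      moreover have "\<kappa> * \<epsilon> = M + 1" using \<epsilon> by (simp add: \<kappa>_def)
      ultimately show ?thesis using M(2)[OF xK] by simp
    qed
  qed
  also have "L (q + \<kappa> *\<^sub>R d) = L p + \<delta> + \<kappa> * (L f - c)"
    by (simp add: q_def d_def add diff scale unital)
  also have "\<dots> \<le> L p + \<delta>"
    using \<kappa> opt by (simp add: mult_nonneg_nonpos)
  finally show "0 \<le> L p + \<delta>" .
qed

end

section \<open>Finitely atomic moment sequences\<close>

text \<open>The tms of degree \<open>d\<close> of the measure with mass \<open>w v\<close> at \<open>v \<in> S\<close>.  A mass may be zero: \<open>S\<close> will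
  be the set of all minimizers, and a limit need not charge each of them.\<close>
definition has_atoms :: "(real ^ 'n::finite) set \<Rightarrow> (real ^ 'n \<Rightarrow> real) \<Rightarrow> nat \<Rightarrow> 'n tms \<Rightarrow> bool" where
  "has_atoms S w d z \<longleftrightarrow> z \<in> tms_space d \<and>
     (\<forall>\<alpha>\<in>expos d. Poly_Mapping.lookup z \<alpha> = (\<Sum>v\<in>S. w v * mon_eval \<alpha> v))"

lemma riesz_atoms:
  assumes z: "has_atoms S w d z" and "total_deg p \<le> d"
  shows "riesz z p = (\<Sum>v\<in>S. w v * poly_eval p v)"
proof -
  have sup: "moment_functional \<phi> p = (\<Sum>\<alpha>\<in>expos d. Poly_Mapping.lookup p \<alpha> * \<phi> \<alpha>)" for \<phi>
    by (rule moment_functional_superset) (use assms in \<open>simp_all add: total_deg_le_iff\<close>)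
  have "riesz z p = (\<Sum>\<alpha>\<in>expos d. \<Sum>v\<in>S. w v * (Poly_Mapping.lookup p \<alpha> * mon_eval \<alpha> v))"
    unfolding riesz_conv sup
    by (rule sum.cong) (use z in \<open>auto simp: has_atoms_def sum_distrib_left mult_ac\<close>)
  also have "\<dots> = (\<Sum>v\<in>S. w v * poly_eval p v)"
    using fun_cong[OF poly_eval_conv, of p] by (subst sum.swap) (simp add: sup sum_distrib_left)
  finally show ?thesis .
qed

lemma total_deg_localizing_entry:
  assumes "half_deg h \<le> k" "\<alpha> \<in> loc_index h k" "\<beta> \<in> loc_index h k"
  shows "total_deg (h * monomial \<alpha> * monomial \<beta>) \<le> 2 * k"
proof -
  have "total_deg (h * monomial \<alpha> * monomial \<beta>) \<le> total_deg h + expo_deg \<alpha> + expo_deg \<beta>"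
    using total_deg_mult[of "h * monomial \<alpha>" "monomial \<beta>"] total_deg_mult[of h "monomial \<alpha>"]
    by (simp add: total_deg_monomial)
  also have "\<dots> \<le> 2 * half_deg h + (k - half_deg h) + (k - half_deg h)"
    using assms half_deg_bound[of h] by (intro add_mono) (auto simp: loc_index_def expos_def)
  also have "\<dots> = 2 * k" using assms(1) by simp
  finally show ?thesis .
qed

lemma loc_mat_atoms:
  assumes "has_atoms S w (2 * k) z" "half_deg h \<le> k" "\<alpha> \<in> loc_index h k" "\<beta> \<in> loc_index h k"
  shows "loc_mat h z \<alpha> \<beta> = (\<Sum>v\<in>S. w v * poly_eval h v * mon_eval \<alpha> v * mon_eval \<beta> v)"
  using riesz_atoms[OF assms(1) total_deg_localizing_entry[OF assms(2-4)]]
  by (simp add: loc_mat_def mult.assoc)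

lemma half_deg_le_constr_deg:
  assumes "h \<in> set (1 # g)"
  shows "half_deg h \<le> constr_deg g"
proof (cases "h = 1")
  case False
  with assms show ?thesis by (auto simp: constr_deg_def intro!: Max_ge)
qed simp

text \<open>The quadratic form of the localizing matrix of \<open>h\<close> at \<open>c\<close> is
  \<open>\<Sum>v. w v * h(v) * (\<Sum>\<alpha>. c \<alpha> * v ^ \<alpha>)\<^sup>2\<close>, which is a sum of nonnegative terms.\<close>
lemma mom_feasible_atoms:
  assumes z: "has_atoms S w (2 * k) z" and S: "S \<subseteq> feasible_set g"
    and w: "\<And>v. v \<in> S \<Longrightarrow> 0 \<le> w v" "sum w S = 1" and k: "constr_deg g \<le> k"
  shows "mom_feasible g k z"
  unfolding mom_feasible_def
proof (intro conjI ballI)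
  show "z \<in> tms_space (2 * k)" using z by (simp add: has_atoms_def)
  show "riesz z 1 = 1"
    using riesz_atoms[OF z, of 1] w(2) by (simp add: total_deg_def)
  fix h assume h: "h \<in> set (1 # g)"
  then have hk: "half_deg h \<le> k" using half_deg_le_constr_deg k order_trans by blast
  have hv: "0 \<le> poly_eval h v" if "v \<in> S" for v
    using h S that by (auto simp: feasible_set_def)
  show "psd_on (loc_index h k) (loc_mat h z)"
    unfolding psd_on_def
  proof (intro conjI ballI allI)
    fix \<alpha> \<beta> show "loc_mat h z \<alpha> \<beta> = loc_mat h z \<beta> \<alpha>"
      by (simp add: loc_mat_def mult_ac)
  next
    fix c :: "'a expo \<Rightarrow> real"
    let ?A = "loc_index h k"
    have "(\<Sum>\<alpha>\<in>?A. \<Sum>\<beta>\<in>?A. c \<alpha> * loc_mat h z \<alpha> \<beta> * c \<beta>) =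
        (\<Sum>\<alpha>\<in>?A. \<Sum>\<beta>\<in>?A. \<Sum>v\<in>S. w v * poly_eval h v * ((c \<alpha> * mon_eval \<alpha> v) * (c \<beta> * mon_eval \<beta> v)))"
      by (intro sum.cong refl)
         (simp add: loc_mat_atoms[OF z hk] sum_distrib_left sum_distrib_right mult_ac)
    also have "\<dots> = (\<Sum>\<alpha>\<in>?A. \<Sum>v\<in>S. \<Sum>\<beta>\<in>?A. w v * poly_eval h v * ((c \<alpha> * mon_eval \<alpha> v) * (c \<beta> * mon_eval \<beta> v)))"
      by (rule sum.cong[OF refl]) (rule sum.swap)
    also have "\<dots> = (\<Sum>v\<in>S. \<Sum>\<alpha>\<in>?A. \<Sum>\<beta>\<in>?A. w v * poly_eval h v * ((c \<alpha> * mon_eval \<alpha> v) * (c \<beta> * mon_eval \<beta> v)))"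
      by (rule sum.swap)
    also have "\<dots> = (\<Sum>v\<in>S. w v * poly_eval h v * (\<Sum>\<alpha>\<in>?A. c \<alpha> * mon_eval \<alpha> v)\<^sup>2)"
      by (simp add: power2_eq_square sum_product flip: sum_distrib_left)
    also have "0 \<le> \<dots>"
      using w hv by (intro sum_nonneg mult_nonneg_nonneg) auto
    finally show "0 \<le> (\<Sum>\<alpha>\<in>?A. \<Sum>\<beta>\<in>?A. c \<alpha> * loc_mat h z \<alpha> \<beta> * c \<beta>)" .
  qed
qed

definition dirac_tms :: "nat \<Rightarrow> real ^ 'n::finite \<Rightarrow> 'n tms" where
  "dirac_tms d x = (\<Sum>\<alpha>\<in>expos d. Poly_Mapping.single \<alpha> (mon_eval \<alpha> x))"

lemma lookup_sum_single:
  assumes "finite A"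
  shows "Poly_Mapping.lookup (\<Sum>\<beta>\<in>A. Poly_Mapping.single \<beta> (c \<beta>)) \<alpha> = (if \<alpha> \<in> A then c \<alpha> else 0)"
  using assms by (simp add: lookup_sum lookup_single when_def)

lemma lookup_dirac_tms:
  "Poly_Mapping.lookup (dirac_tms d x) \<alpha> = (if \<alpha> \<in> expos d then mon_eval \<alpha> x else 0)"
  by (simp add: dirac_tms_def lookup_sum_single)

lemma has_atoms_dirac: "has_atoms {x} (\<lambda>_. 1) d (dirac_tms d x)"
  by (auto simp: has_atoms_def tms_space_def in_keys_iff lookup_dirac_tms split: if_splits)

lemma mom_value_le_feasible_value:
  assumes "x \<in> feasible_set g" "max (half_deg f) (constr_deg g) \<le> k"
  shows "mom_value f g k \<le> ereal (poly_eval f x)"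
proof -
  have "mom_feasible g k (dirac_tms (2 * k) x)"
    by (rule mom_feasible_atoms[OF has_atoms_dirac]) (use assms in auto)
  moreover have "riesz (dirac_tms (2 * k) x) f = poly_eval f x"
    using riesz_atoms[OF has_atoms_dirac, of f "2 * k" x] half_deg_bound[of f] assms by simp
  ultimately show ?thesis
    unfolding mom_value_def by (metis INF_lower mem_Collect_eq)
qed

text \<open>A product of \<open>card S - 1\<close> affine polynomials, one for each other point \<open>u\<close>, taken in a
  coordinate in which \<open>u\<close> differs from \<open>v\<close>.\<close>
lemma interpolation_poly:
  fixes S :: "(real ^ 'n::finite) set"
  assumes "finite S" "v \<in> S"
  shows "\<exists>e. total_deg e \<le> card S - 1 \<and> (\<forall>u\<in>S. poly_eval e u = (if u = v then 1 else 0))"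
proof -
  have "\<exists>l. total_deg l \<le> 1 \<and> poly_eval l v = 1 \<and> poly_eval l u = 0" if neq: "u \<noteq> v" for u
  proof -
    obtain i where i: "u $ i \<noteq> v $ i" using neq unfolding vec_eq_iff by blast
    let ?l = "(1 / (v $ i - u $ i)) *\<^sub>R (var_poly i - (u $ i) *\<^sub>R 1)"
    have "Poly_Mapping.keys ?l \<subseteq> {0, Poly_Mapping.single i 1}"
      by (auto simp: in_keys_iff lookup_minus var_poly_def monomial_def lookup_single lookup_one when_def
          split: if_splits)
    then have "total_deg ?l \<le> 1"
      unfolding total_deg_le_iff using subsetD by (fastforce simp: expos_def)
    moreover have "poly_eval ?l v = 1" "poly_eval ?l u = 0" using i by simp_all
    ultimately show ?thesis by blast
  qed
  then obtain l where l: "\<And>u. u \<noteq> v \<Longrightarrow> total_deg (l u) \<le> 1 \<and> poly_eval (l u) v = 1 \<and> poly_eval (l u) u = 0"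
    by metis
  let ?e = "\<Prod>u\<in>S - {v}. l u"
  have "total_deg ?e \<le> (\<Sum>u\<in>S - {v}. total_deg (l u))" by (rule total_deg_prod)
  also have "\<dots> \<le> (\<Sum>u\<in>S - {v}. 1)" by (rule sum_mono) (use l in auto)
  also have "\<dots> = card S - 1" using assms by simp
  finally have "total_deg ?e \<le> card S - 1" .
  moreover have "poly_eval ?e u = (if u = v then 1 else 0)" if "u \<in> S" for u
  proof (cases "u = v")
    case True
    then show ?thesis using l by (auto intro!: prod.neutral)
  next
    case False
    then show ?thesis using l that assms by (auto intro!: prod_zero)
  qed
  ultimately show ?thesis by blast
qed

text \<open>The moment matrix of an atomic tms is the sum of the rank one matrices \<open>w v * [v]\<^sub>s [v]\<^sub>s\<^sup>T\<close>,
  where \<open>[v]\<^sub>s\<close> is the vector of monomials at \<open>v\<close>.\<close>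
lemma column_moment_matrix_atoms:
  assumes "has_atoms S w (2 * t) z" "s \<le> t" "\<beta> \<in> expos s"
  shows "column_on (expos s) (loc_mat 1 (tms_trunc (2 * s) z)) \<beta> =
    (\<Sum>v\<in>S. (w v * mon_eval \<beta> v) *\<^sub>R dirac_tms s v)"
proof (rule poly_mapping_eqI)
  fix \<alpha>
  have "loc_mat 1 (tms_trunc (2 * s) z) \<alpha> \<beta> = (\<Sum>v\<in>S. w v * mon_eval \<beta> v * mon_eval \<alpha> v)"
    if "\<alpha> \<in> expos s"
  proof -
    have "\<alpha> + \<beta> \<in> expos (2 * s)" "\<alpha> + \<beta> \<in> expos (2 * t)"
      using that assms(2,3) by (auto simp: expos_def expo_deg_add)
    then show ?thesis
      using assms(1)
      by (simp add: loc_mat_def lookup_tms_trunc has_atoms_def mon_eval_add mult_ac flip: monomial_add)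
  qed
  then show "Poly_Mapping.lookup (column_on (expos s) (loc_mat 1 (tms_trunc (2 * s) z)) \<beta>) \<alpha> =
      Poly_Mapping.lookup (\<Sum>v\<in>S. (w v * mon_eval \<beta> v) *\<^sub>R dirac_tms s v) \<alpha>"
    unfolding column_on_def lookup_sum_single[OF finite_expos]
    by (simp add: lookup_sum lookup_dirac_tms)
qed

text \<open>Once the order \<open>s\<close> admits interpolation polynomials for \<open>S\<close>, pairing with them shows that the
  vectors \<open>[v]\<^sub>s\<close> are linearly independent, and applying the moment matrix to their coefficients
  recovers every \<open>[v]\<^sub>s\<close> of nonzero mass from the columns.  So the rank is the number of
  atoms, for every such \<open>s\<close>; this is where flatness comes from.\<close>
lemma moment_rank_atoms:
  fixes S :: "(real ^ 'n::finite) set"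
  assumes "finite S" and z: "has_atoms S w (2 * t) z" and "s \<le> t" and s: "card S - 1 \<le> s"
  shows "moment_rank s z = card {v \<in> S. w v \<noteq> 0}"
proof -
  let ?T = "{v \<in> S. w v \<noteq> 0}"
  let ?col = "column_on (expos s) (loc_mat 1 (tms_trunc (2 * s) z))"
  have "\<forall>v\<in>S. \<exists>e. total_deg e \<le> s \<and> (\<forall>u\<in>S. poly_eval e u = (if u = v then 1 else 0))"
    using interpolation_poly[OF \<open>finite S\<close>] s order_trans by blast
  then obtain e where e: "\<And>v. v \<in> S \<Longrightarrow> total_deg (e v) \<le> s"
    "\<And>u v. v \<in> S \<Longrightarrow> u \<in> S \<Longrightarrow> poly_eval (e v) u = (if u = v then 1 else 0)"
    by metis
  have riesz_dirac: "riesz (dirac_tms s u) (e v) = (if u = v then 1 else 0)" if "u \<in> S" "v \<in> S" for u v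
    using riesz_atoms[OF has_atoms_dirac e(1)] that by (simp add: e(2))
  have inj: "inj_on (dirac_tms s) S"
    by (rule inj_onI) (metis riesz_dirac zero_neq_one)
  have lin: "linear (\<lambda>y. riesz y p)" for p :: "'n mpoly"
    by (rule linearI) (simp_all add: riesz_def lookup_add distrib_left sum.distrib sum_distrib_left mult_ac)
  have ind: "independent (dirac_tms s ` ?T)"
  proof (rule independent_if_scalars_zero)
    show "finite (dirac_tms s ` ?T)" using \<open>finite S\<close> by simp
    fix c x assume sum0: "(\<Sum>x\<in>dirac_tms s ` ?T. c x *\<^sub>R x) = 0" and "x \<in> dirac_tms s ` ?T"
    then obtain v where v: "v \<in> ?T" "x = dirac_tms s v" by blast
    have injT: "inj_on (dirac_tms s) ?T" using inj by (rule inj_on_subset) auto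
    have "0 = riesz (\<Sum>u\<in>?T. c (dirac_tms s u) *\<^sub>R dirac_tms s u) (e v)"
      using sum0 by (simp add: sum.reindex[OF injT] linear_0[OF lin])
    also have "\<dots> = (\<Sum>u\<in>?T. c (dirac_tms s u) * (if u = v then 1 else 0))"
      using v by (simp add: linear_sum[OF lin] linear_cmul[OF lin] riesz_dirac)
    also have "\<dots> = c x" using v \<open>finite S\<close> by (simp add: if_distrib cong: if_cong)
    finally show "c x = 0" by simp
  qed
  have span1: "?col ` expos s \<subseteq> span (dirac_tms s ` ?T)"
  proof
    fix y assume "y \<in> ?col ` expos s"
    then obtain \<beta> where \<beta>: "\<beta> \<in> expos s" "y = ?col \<beta>" by blast
    have "y = (\<Sum>v\<in>?T. (w v * mon_eval \<beta> v) *\<^sub>R dirac_tms s v)"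
      unfolding \<beta>(2) column_moment_matrix_atoms[OF z \<open>s \<le> t\<close> \<beta>(1)]
      by (rule sum.mono_neutral_right) (use \<open>finite S\<close> in auto)
    also have "\<dots> \<in> span (dirac_tms s ` ?T)"
      by (intro span_sum span_scale span_base) auto
    finally show "y \<in> span (dirac_tms s ` ?T)" .
  qed
  have span2: "dirac_tms s ` ?T \<subseteq> span (?col ` expos s)"
  proof
    fix x assume "x \<in> dirac_tms s ` ?T"
    then obtain v where v: "v \<in> S" "w v \<noteq> 0" "x = dirac_tms s v" by blast
    have ev: "poly_eval (e v) u = (\<Sum>\<beta>\<in>expos s. Poly_Mapping.lookup (e v) \<beta> * mon_eval \<beta> u)" for u
      using fun_cong[OF poly_eval_conv, of "e v" u] e(1)[OF v(1)]
      by (simp add: moment_functional_superset[of "expos s"] total_deg_le_iff)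
    have "(\<Sum>\<beta>\<in>expos s. Poly_Mapping.lookup (e v) \<beta> *\<^sub>R ?col \<beta>)
        = (\<Sum>\<beta>\<in>expos s. \<Sum>u\<in>S. (Poly_Mapping.lookup (e v) \<beta> * (w u * mon_eval \<beta> u)) *\<^sub>R dirac_tms s u)"
      by (intro sum.cong refl)
         (simp add: column_moment_matrix_atoms[OF z \<open>s \<le> t\<close>] scaleR_sum_right)
    also have "\<dots> = (\<Sum>u\<in>S. (w u * poly_eval (e v) u) *\<^sub>R dirac_tms s u)"
      unfolding ev by (subst sum.swap) (simp add: sum_distrib_left scaleR_sum_left mult.left_commute)
    also have "\<dots> = (\<Sum>u\<in>S. if u = v then w v *\<^sub>R x else 0)"
      by (rule sum.cong) (use v in \<open>auto simp: e(2)\<close>)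
    also have "\<dots> = w v *\<^sub>R x" using v \<open>finite S\<close> by simp
    finally have "x = (1 / w v) *\<^sub>R (\<Sum>\<beta>\<in>expos s. Poly_Mapping.lookup (e v) \<beta> *\<^sub>R ?col \<beta>)"
      using v by simp
    also have "\<dots> \<in> span (?col ` expos s)"
      by (intro span_sum span_scale span_base) auto
    finally show "x \<in> span (?col ` expos s)" .
  qed
  have "span (?col ` expos s) = span (dirac_tms s ` ?T)"
    unfolding span_eq using span1 span2 by (rule conjI)
  then have "dim (span (?col ` expos s)) = dim (span (dirac_tms s ` ?T))"
    by (rule arg_cong)
  then have "dim (?col ` expos s) = dim (dirac_tms s ` ?T)"
    by (simp only: dim_span)
  also have "\<dots> = card (dirac_tms s ` ?T)"
    using ind by (rule dim_eq_card_independent)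
  also have "\<dots> = card ?T"
    using inj by (intro card_image inj_on_subset[OF inj]) auto
  finally show ?thesis
    by (simp add: moment_rank_def rank_on_def loc_index_def)
qed

lemma moment_set_atoms:
  fixes S :: "(real ^ 'n::finite) set"
  assumes "finite S" and z: "has_atoms S w d z"
    and w: "\<And>v. v \<in> S \<Longrightarrow> 0 \<le> w v" "sum w S = 1"
  shows "z \<in> moment_set S d"
proof -
  define P where "P = embed_pmf (\<lambda>v. if v \<in> S then w v else 0)"
  have "(\<integral>\<^sup>+ v. ennreal (if v \<in> S then w v else 0) \<partial>count_space UNIV) = 1"
  proof -
    have "(\<integral>\<^sup>+ v. ennreal (if v \<in> S then w v else 0) \<partial>count_space UNIV) = (\<Sum>v\<in>S. ennreal (if v \<in> S then w v else 0))"
      by (rule nn_integral_count_space'[OF \<open>finite S\<close>]) auto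
    also have "\<dots> = ennreal (sum w S)" using w by (simp add: sum_ennreal)
    finally show ?thesis by (simp add: w)
  qed
  then have P: "pmf P v = (if v \<in> S then w v else 0)" for v
    unfolding P_def using w by (subst pmf_embed_pmf) auto
  have supp: "set_pmf P \<subseteq> S" by (auto simp: set_pmf_iff P split: if_splits)
  define \<mu> :: "(real ^ 'n) measure" where "\<mu> = distr (measure_pmf P) borel (\<lambda>x. x)"
  have "S \<in> sets borel" using \<open>finite S\<close> by (simp add: finite_imp_closed)
  have meas: "mon_eval \<alpha> \<in> borel_measurable borel" for \<alpha> :: "'n expo"
    using continuous_on_poly_eval[of UNIV "monomial \<alpha>"]
    by (intro borel_measurable_continuous_onI) simp
  have int: "(LINT x:S|\<mu>. mon_eval \<alpha> x) = (\<Sum>v\<in>S. w v * mon_eval \<alpha> v)" for \<alpha>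
  proof -
    have "(LINT x:S|\<mu>. mon_eval \<alpha> x) = (LINT x|measure_pmf P. indicator S x *\<^sub>R mon_eval \<alpha> x)"
      unfolding \<mu>_def set_lebesgue_integral_def
      by (rule integral_distr) (use meas \<open>S \<in> sets borel\<close> in auto)
    also have "\<dots> = (\<Sum>v\<in>S. indicator S v *\<^sub>R mon_eval \<alpha> v * pmf P v)"
      by (rule integral_measure_pmf_real) (use \<open>finite S\<close> supp in auto)
    also have "\<dots> = (\<Sum>v\<in>S. w v * mon_eval \<alpha> v)"
      by (rule sum.cong) (auto simp: P)
    finally show ?thesis .
  qed
  have "sets \<mu> = sets borel" by (simp add: \<mu>_def)
  moreover have "prob_space \<mu>"
    unfolding \<mu>_def by (rule measure_pmf.prob_space_distr) simp
  moreover have "AE x in \<mu>. x \<in> S"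
    unfolding \<mu>_def using supp \<open>S \<in> sets borel\<close>
    by (subst AE_distr_iff) (auto simp: AE_measure_pmf_iff)
  ultimately show ?thesis
    using z int unfolding moment_set_def has_atoms_def by auto
qed

context positive_functional
begin

text \<open>\<open>L\<close> is monotone with respect to the values on \<open>S\<close>, hence it only depends on them.  So \<open>p\<close> may be
  replaced by its Lagrange interpolant, and the weights are the values of \<open>L\<close> at the Lagrange
  polynomials.\<close>
theorem atomic_representation:
  assumes "finite G" and loc: "\<And>h. h \<in> G \<Longrightarrow> localizes h"
    and min: "\<And>x. \<forall>h\<in>G. 0 \<le> poly_eval h x \<Longrightarrow> c \<le> poly_eval f x"
    and opt: "L f \<le> c"
    and S: "S = {x. (\<forall>h\<in>G. 0 \<le> poly_eval h x) \<and> poly_eval f x = c}" and "finite S"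
  shows "\<exists>w. (\<forall>v\<in>S. 0 \<le> w v) \<and> sum w S = 1 \<and> (\<forall>p. L p = (\<Sum>v\<in>S. w v * poly_eval p v))"
proof -
  have mono: "0 \<le> L p" if "\<And>x. x \<in> S \<Longrightarrow> 0 \<le> poly_eval p x" for p
    by (rule nonneg_if_nonneg_on_minimizers[OF assms(1-4)]) (use that S in auto)
  have cong: "L p = L q" if eq: "\<And>x. x \<in> S \<Longrightarrow> poly_eval p x = poly_eval q x" for p q
    using mono[of "p - q"] mono[of "q - p"] eq by (simp add: diff)
  obtain e where e: "\<And>u v. v \<in> S \<Longrightarrow> u \<in> S \<Longrightarrow> poly_eval (e v) u = (if u = v then 1 else 0)"
    using interpolation_poly[OF \<open>finite S\<close>] by metis
  have rep: "L p = (\<Sum>v\<in>S. L (e v) * poly_eval p v)" for p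
  proof -
    have "L p = L (\<Sum>v\<in>S. poly_eval p v *\<^sub>R e v)"
    proof (rule cong)
      fix x assume x: "x \<in> S"
      have "poly_eval (\<Sum>v\<in>S. poly_eval p v *\<^sub>R e v) x = (\<Sum>v\<in>S. if x = v then poly_eval p v else 0)"
        unfolding poly_eval_sum by (rule sum.cong) (use x in \<open>auto simp: e\<close>)
      then show "poly_eval p x = poly_eval (\<Sum>v\<in>S. poly_eval p v *\<^sub>R e v) x"
        using x \<open>finite S\<close> by simp
    qed
    then show ?thesis by (simp add: sum scale mult.commute)
  qed
  have "0 \<le> L (e v)" if "v \<in> S" for v
    by (rule mono) (use that in \<open>simp add: e\<close>)
  moreover have "(\<Sum>v\<in>S. L (e v)) = 1"
    using rep[of 1] unital by simp
  ultimately show ?thesis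
    using rep by (intro exI[of _ "\<lambda>v. L (e v)"] conjI ballI allI)
qed

end

section \<open>Limits of feasible moment sequences\<close>

lemma diagonal_convergent_subsequence:
  fixes X :: "'i \<Rightarrow> nat \<Rightarrow> real"
  assumes "countable (UNIV :: 'i set)" and bdd: "\<And>i. bounded (range (X i))"
  shows "\<exists>r :: nat \<Rightarrow> nat. strict_mono r \<and> (\<forall>i. convergent (X i \<circ> r))"
proof -
  interpret subseqs "\<lambda>n s. convergent (X (from_nat_into UNIV n) \<circ> s)"
  proof
    fix n and s :: "nat \<Rightarrow> nat"
    have "bounded (range (X (from_nat_into UNIV n) \<circ> s))"
      by (rule bounded_subset[OF bdd]) auto
    then show "\<exists>r'. strict_mono r' \<and> convergent (X (from_nat_into UNIV n) \<circ> (s \<circ> r'))"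
      using bounded_imp_convergent_subsequence unfolding convergent_def comp_assoc[symmetric] by blast
  qed
  have stable: "convergent (X (from_nat_into UNIV k) \<circ> (diagseq \<circ> (+) (Suc k)))" for k
    by (rule diagseq_holds) (use convergent_subseq_convergent in \<open>simp add: comp_assoc[symmetric]\<close>)
  have "convergent (X i \<circ> diagseq)" for i
  proof -
    obtain k where k: "from_nat_into UNIV k = i"
      using from_nat_into_surj[OF assms(1)] by blast
    obtain l where "(\<lambda>n. X i (diagseq (Suc k + n))) \<longlonglongrightarrow> l"
      using stable[of k] by (auto simp: convergent_def k comp_def)
    then have "(\<lambda>n. (X i \<circ> diagseq) (n + Suc k)) \<longlonglongrightarrow> l"
      by (simp add: comp_def add.commute)
    then show ?thesis
      using LIMSEQ_offset unfolding convergent_def by blast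
  qed
  with subseq_diagseq show ?thesis by blast
qed

lemma countable_expo: "countable (UNIV :: 'n::finite expo set)"
proof -
  have "(UNIV :: 'n expo set) = (\<Union>d. expos d)" by (auto simp: expos_def)
  then show ?thesis by (metis countable_UN countableI_type countable_finite finite_expos)
qed

lemma expo_induct [case_names zero add]:
  fixes \<alpha> :: "'n::finite expo"
  assumes "P 0" and "\<And>i \<alpha>. P \<alpha> \<Longrightarrow> P (Poly_Mapping.single i 1 + \<alpha>)"
  shows "P \<alpha>"
proof (induction "expo_deg \<alpha>" arbitrary: \<alpha>)
  case 0
  then have "\<alpha> = 0"
    by (intro poly_mapping_eqI) (simp add: expo_deg_def)
  with assms(1) show ?case by simp
next
  case (Suc d)
  then obtain i where i: "0 < Poly_Mapping.lookup \<alpha> i"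
    by (metis expo_deg_def gr0I sum.neutral nat.distinct(1))
  define \<beta> where "\<beta> = \<alpha> - Poly_Mapping.single i 1"
  have "\<alpha> = Poly_Mapping.single i 1 + \<beta>"
    by (rule poly_mapping_eqI)
       (use i in \<open>auto simp: \<beta>_def lookup_add minus_poly_mapping.rep_eq lookup_single when_def\<close>)
  moreover from this have "d = expo_deg \<beta>"
    using Suc.hyps(2) by (simp add: expo_deg_add)
  ultimately show ?case
    using Suc.hyps(1)[of \<beta>] assms(2) by simp
qed

lemma abs_lookup_diff_le_dist:
  fixes x y :: "'a \<Rightarrow>\<^sub>0 real"
  shows "\<bar>Poly_Mapping.lookup x \<alpha> - Poly_Mapping.lookup y \<alpha>\<bar> \<le> dist x y"
proof (cases "\<alpha> \<in> Poly_Mapping.keys x \<union> Poly_Mapping.keys y")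
  case True
  then show ?thesis
    unfolding dist_poly_mapping_def dist_real_def[symmetric] by (intro member_le_sum) auto
qed (simp add: in_keys_iff)

lemma tendsto_lookup:
  fixes X :: "'b \<Rightarrow> 'a \<Rightarrow>\<^sub>0 real"
  assumes "(X \<longlongrightarrow> z) F"
  shows "((\<lambda>j. Poly_Mapping.lookup (X j) \<alpha>) \<longlongrightarrow> Poly_Mapping.lookup z \<alpha>) F"
  by (rule metric_tendsto_imp_tendsto[OF assms])
     (simp add: dist_real_def abs_lookup_diff_le_dist)

text \<open>Every inequality below holds from some order on that depends on the polynomials involved.
  This replaces all bookkeeping of degrees, since only limits along the sequence are
  considered.\<close>
locale feasible_moment_sequence =
  fixes g :: "'n::finite mpoly list" and y :: "nat \<Rightarrow> 'n tms"
  assumes feasible: "\<forall>\<^sub>F k in sequentially. mom_feasible g k (y k)"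
begin

lemma eventually_localized_nonneg:
  assumes h: "h \<in> set (1 # g)"
  shows "\<forall>\<^sub>F k in sequentially. 0 \<le> riesz (y k) (h * p\<^sup>2)"
  using feasible eventually_ge_at_top[of "half_deg h + total_deg p"]
proof eventually_elim
  case (elim k)
  then have "psd_on (loc_index h k) (loc_mat h (y k))"
    using h by (auto simp: mom_feasible_def)
  then have "0 \<le> (\<Sum>\<alpha>\<in>loc_index h k. \<Sum>\<beta>\<in>loc_index h k.
      Poly_Mapping.lookup p \<alpha> * loc_mat h (y k) \<alpha> \<beta> * Poly_Mapping.lookup p \<beta>)"
    by (simp add: psd_on_def)
  also have "\<dots> = riesz (y k) (h * p * p)"
    by (rule loc_mat_bilinear) (use elim in simp_all)
  finally show ?case
    by (simp add: power2_eq_square mult.assoc)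
qed

text \<open>Multiplying a sum of squares by \<open>p\<^sup>2\<close> gives the sum of squares of the products, which is handled
  term by term.\<close>
lemma eventually_localized_sos_nonneg:
  assumes h: "h \<in> set (1 # g)" and "sos \<sigma>"
  shows "\<forall>\<^sub>F k in sequentially. 0 \<le> riesz (y k) (h * \<sigma> * p\<^sup>2)"
proof -
  have "\<forall>\<^sub>F k in sequentially. 0 \<le> riesz (y k) (h * (\<Sum>q\<leftarrow>qs. q\<^sup>2) * p\<^sup>2)" for qs
  proof (induction qs)
    case (Cons q qs)
    have split: "h * (\<Sum>q\<leftarrow>q # qs. q\<^sup>2) * p\<^sup>2 = h * (q * p)\<^sup>2 + h * (\<Sum>q\<leftarrow>qs. q\<^sup>2) * p\<^sup>2"
      by (simp add: power_mult_distrib algebra_simps)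
    from Cons eventually_localized_nonneg[OF h, of "q * p"] show ?case
      by eventually_elim (unfold split, simp add: riesz_add)
  qed (simp add: riesz_zero)
  with \<open>sos \<sigma>\<close> show ?thesis by (auto simp: sos_def)
qed

lemma eventually_quadratic_module_nonneg:
  assumes "q \<in> quadratic_module k\<^sub>0 g"
  shows "\<forall>\<^sub>F k in sequentially. 0 \<le> riesz (y k) (q * p\<^sup>2)"
proof -
  obtain \<sigma> where q: "q = (\<Sum>i\<le>length g. ((1 # g) ! i) * \<sigma> i)" and \<sigma>: "\<And>i. i \<le> length g \<Longrightarrow> sos (\<sigma> i)"
    using assms unfolding quadratic_module_def by blast
  have "\<forall>\<^sub>F k in sequentially. \<forall>i\<in>{..length g}. 0 \<le> riesz (y k) (((1 # g) ! i) * \<sigma> i * p\<^sup>2)"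
  proof (intro eventually_ball_finite ballI)
    fix i assume i: "i \<in> {..length g}"
    then have "(1 # g) ! i \<in> set (1 # g)" by (intro nth_mem) simp
    with \<sigma> i show "\<forall>\<^sub>F k in sequentially. 0 \<le> riesz (y k) (((1 # g) ! i) * \<sigma> i * p\<^sup>2)"
      by (intro eventually_localized_sos_nonneg) auto
  qed simp
  then show ?thesis
    by eventually_elim (auto simp: q sum_distrib_right riesz_sum intro: sum_nonneg)
qed

lemma eventually_square_nonneg: "\<forall>\<^sub>F k in sequentially. 0 \<le> riesz (y k) (p\<^sup>2)"
  using eventually_localized_nonneg[of 1 p] by simp

lemma eventually_unital: "\<forall>\<^sub>F k in sequentially. riesz (y k) 1 = 1"
  using feasible by eventually_elim (simp add: mom_feasible_def)

end

locale archimedean_moment_sequence = feasible_moment_sequence g y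
  for g :: "'n::finite mpoly list" and y :: "nat \<Rightarrow> 'n tms" +
  fixes R :: real and k\<^sub>0 :: nat
  assumes R_pos: "0 < R"
    and archimedean: "const_poly R - sq_norm_poly \<in> quadratic_module k\<^sub>0 g"
begin

text \<open>\<open>R * p\<^sup>2 - \<Sum>\<^sub>j (x\<^sub>j * p)\<^sup>2\<close> has a nonnegative value, and so have the other squares
  \<open>(x\<^sub>j * p)\<^sup>2\<close>.\<close>
lemma eventually_var_square_le:
  "\<forall>\<^sub>F k in sequentially. riesz (y k) ((var_poly i * p)\<^sup>2) \<le> R * riesz (y k) (p\<^sup>2)"
proof -
  have split: "(const_poly R - sq_norm_poly) * p\<^sup>2 = R *\<^sub>R p\<^sup>2 - (\<Sum>j\<in>UNIV. (var_poly j * p)\<^sup>2)"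
    by (simp add: const_poly_conv_scaleR sq_norm_poly_def left_diff_distrib sum_distrib_right power_mult_distrib)
  have "\<forall>\<^sub>F k in sequentially. \<forall>j\<in>UNIV. 0 \<le> riesz (y k) ((var_poly j * p)\<^sup>2)"
    by (intro eventually_ball_finite ballI eventually_square_nonneg) simp
  with eventually_quadratic_module_nonneg[OF archimedean, of p] show ?thesis
  proof eventually_elim
    case (elim k)
    have "riesz (y k) ((var_poly i * p)\<^sup>2) \<le> (\<Sum>j\<in>UNIV. riesz (y k) ((var_poly j * p)\<^sup>2))"
      using elim(2) by (intro member_le_sum) auto
    with elim(1) show ?case
      unfolding split by (simp add: linear_diff[OF linear_riesz] linear_cmul[OF linear_riesz] riesz_sum)
  qed
qed

lemma eventually_even_moment_le:
  "\<forall>\<^sub>F k in sequentially. riesz (y k) ((monomial \<alpha>)\<^sup>2) \<le> R ^ expo_deg \<alpha>"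
proof (induction \<alpha> rule: expo_induct)
  case zero
  then show ?case using eventually_unital by eventually_elim simp
next
  case (add i \<alpha>)
  with eventually_var_square_le[of i "monomial \<alpha>"] show ?case
  proof eventually_elim
    case (elim k)
    then have "riesz (y k) ((var_poly i * monomial \<alpha>)\<^sup>2) \<le> R * R ^ expo_deg \<alpha>"
      using R_pos by (meson mult_left_mono order_trans less_imp_le)
    then show ?case by (simp add: monomial_add var_poly_def expo_deg_add)
  qed
qed

text \<open>The squares \<open>(1 +- x\<^sup>\<alpha>)\<^sup>2\<close> bound \<open>2 * \<bar>y\<^sub>\<alpha>\<bar>\<close> by \<open>1\<close> plus the even moment.\<close>
lemma eventually_moment_le:
  "\<forall>\<^sub>F k in sequentially. \<bar>Poly_Mapping.lookup (y k) \<alpha>\<bar> \<le> max 1 R ^ expo_deg \<alpha>"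
  using eventually_even_moment_le[of \<alpha>] eventually_unital
    eventually_square_nonneg[of "1 + monomial \<alpha>"] eventually_square_nonneg[of "1 - monomial \<alpha>"]
proof eventually_elim
  case (elim k)
  have plus: "(1 + monomial \<alpha>)\<^sup>2 = 1 + 2 *\<^sub>R monomial \<alpha> + (monomial \<alpha>)\<^sup>2"
    and minus: "(1 - monomial \<alpha>)\<^sup>2 = 1 - 2 *\<^sub>R monomial \<alpha> + (monomial \<alpha>)\<^sup>2"
    by (simp_all add: power2_eq_square algebra_simps scaleR_2)
  have "2 * \<bar>Poly_Mapping.lookup (y k) \<alpha>\<bar> \<le> 1 + R ^ expo_deg \<alpha>"
    using elim unfolding plus minus
    by (simp add: riesz_add linear_diff[OF linear_riesz] linear_cmul[OF linear_riesz] abs_le_iff)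
  moreover have "R ^ expo_deg \<alpha> \<le> max 1 R ^ expo_deg \<alpha>"
    using R_pos by (intro power_mono) auto
  moreover have "1 \<le> max 1 R ^ expo_deg \<alpha>"
    by (intro one_le_power) simp
  ultimately show ?case by linarith
qed

lemma bounded_moment: "bounded (range (\<lambda>k. Poly_Mapping.lookup (y k) \<alpha>))"
proof -
  have "Bseq (\<lambda>k. Poly_Mapping.lookup (y k) \<alpha>)"
    using eventually_moment_le[of \<alpha>] by (intro BfunI[of _ "max 1 R ^ expo_deg \<alpha>"]) simp
  then show ?thesis by (simp add: Bseq_eq_bounded)
qed

lemma bounded_trunc: "bounded (range (\<lambda>k. tms_trunc d (y k)))"
proof -
  have "\<exists>B. \<forall>k. \<bar>Poly_Mapping.lookup (y k) \<alpha>\<bar> \<le> B" for \<alpha>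
    using bounded_moment[of \<alpha>] by (auto simp: bounded_iff)
  then obtain B where B: "\<And>k \<alpha>. \<bar>Poly_Mapping.lookup (y k) \<alpha>\<bar> \<le> B \<alpha>" by metis
  have norm_single: "norm (Poly_Mapping.single \<alpha> c) = \<bar>c\<bar>" for \<alpha> :: "'n expo" and c :: real
    by (simp add: norm_poly_mapping_def dist_poly_mapping_def)
  have "norm (tms_trunc d (y k)) \<le> (\<Sum>\<alpha>\<in>expos d. B \<alpha>)" for k
    unfolding tms_trunc_def by (rule sum_norm_le) (simp add: norm_single B)
  then show ?thesis by (auto simp: bounded_iff)
qed

text \<open>A functional on all polynomials arises when every moment converges along the same subsequence;
  it inherits normalization, the localizing inequalities of all orders, and the bounds on the moments.\<close>
lemma limit_functional:
  fixes r :: "nat \<Rightarrow> nat"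
  assumes r: "strict_mono r"
    and lim: "\<And>\<alpha>. (\<lambda>n. Poly_Mapping.lookup (y (r n)) \<alpha>) \<longlonglongrightarrow> \<phi> \<alpha>"
  shows "(\<lambda>n. riesz (y (r n)) p) \<longlonglongrightarrow> moment_functional \<phi> p"
    and "positive_functional (moment_functional \<phi>) (max 1 R)"
    and "h \<in> set (1 # g) \<Longrightarrow> 0 \<le> moment_functional \<phi> (h * q\<^sup>2)"
proof -
  show conv: "(\<lambda>n. riesz (y (r n)) p) \<longlonglongrightarrow> moment_functional \<phi> p" for p
    unfolding riesz_conv moment_functional_def by (intro tendsto_intros lim)
  have sub: "\<forall>\<^sub>F n in sequentially. Q (r n)" if "\<forall>\<^sub>F k in sequentially. Q k" for Q
    using filterlim_subseq[OF r] that by (rule eventually_compose_filterlim[rotated])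
  show loc: "0 \<le> moment_functional \<phi> (h * q\<^sup>2)" if "h \<in> set (1 # g)" for h q
    by (rule tendsto_lowerbound[OF conv sub[OF eventually_localized_nonneg[OF that]]]) simp
  show "positive_functional (moment_functional \<phi>) (max 1 R)"
  proof (rule positive_functional.intro)
    show "linear (moment_functional \<phi>)" by simp
    show "moment_functional \<phi> 1 = 1"
      by (rule LIMSEQ_unique[OF conv]) (use sub[OF eventually_unital] in \<open>rule tendsto_eventually\<close>)
    show "0 \<le> moment_functional \<phi> (q\<^sup>2)" for q
      using loc[of 1 q] by simp
    show "\<bar>moment_functional \<phi> (monomial \<alpha>)\<bar> \<le> max 1 R ^ expo_deg \<alpha>" for \<alpha>
      by (rule tendsto_upperbound[OF tendsto_rabs[OF conv]])
         (use sub[OF eventually_moment_le] in auto)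
    show "0 < max 1 R" by simp
  qed
qed

end

theorem theorem3p3:
  fixes f :: "'n::finite mpoly" and g :: "'n mpoly list"
    and y :: "nat \<Rightarrow> 'n tms" and t :: nat
  assumes archimedean:
      "\<exists>R>0. \<exists>k\<^sub>0. const_poly R - sq_norm_poly \<in> quadratic_module k\<^sub>0 g"
    and minimizers_nonempty: "minimizers f g \<noteq> {}"
    and minimizers_finite: "finite (minimizers f g)"
    and asymptotically_optimal: "asymptotically_optimal f g y"
    and order: "t \<ge> max (half_deg f) (constr_deg g + card (minimizers f g) - 1)"
  shows "bounded ((\<lambda>k. tms_trunc (2 * t) (y k)) ` {t..}) \<and>
    (\<forall>z. seq_limit_point (\<lambda>j. tms_trunc (2 * t) (y (t + j))) z \<longrightarrow>
       z \<in> moment_set (minimizers f g) (2 * t) \<and> flat_tms g t z)"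
proof -
  let ?S = "minimizers f g"
  obtain x0 where x0: "x0 \<in> ?S" using minimizers_nonempty by blast
  define c where "c = poly_eval f x0"
  have S_eq: "?S = {x. (\<forall>h\<in>set g. 0 \<le> poly_eval h x) \<and> poly_eval f x = c}"
    using x0 by (auto simp: minimizers_def feasible_set_def c_def intro: order_antisym)
  have min: "c \<le> poly_eval f x" if "\<forall>h\<in>set g. 0 \<le> poly_eval h x" for x
    using x0 that by (auto simp: minimizers_def feasible_set_def c_def)
  have card: "0 < card ?S" using minimizers_nonempty minimizers_finite by (simp add: card_gt_0_iff)
  let ?m = "max (half_deg f) (constr_deg g)"
  obtain R k\<^sub>0 where R: "0 < R" "const_poly R - sq_norm_poly \<in> quadratic_module k\<^sub>0 g"
    using archimedean by blast
  have feas: "\<forall>\<^sub>F k in sequentially. mom_feasible g k (y k)"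
    using asymptotically_optimal eventually_sequentially unfolding asymptotically_optimal_def by blast
  interpret archimedean_moment_sequence g y R k\<^sub>0
    by unfold_locales (use feas R in auto)
  have "bounded ((\<lambda>k. tms_trunc (2 * t) (y k)) ` {t..})"
    by (rule bounded_subset[OF bounded_trunc]) auto
  moreover have "z \<in> moment_set ?S (2 * t) \<and> flat_tms g t z"
    if z: "seq_limit_point (\<lambda>j. tms_trunc (2 * t) (y (t + j))) z" for z
  proof -
    obtain r1 :: "nat \<Rightarrow> nat" where r1: "strict_mono r1"
      and lim_z: "(\<lambda>n. tms_trunc (2 * t) (y (t + r1 n))) \<longlonglongrightarrow> z"
      using z by (auto simp: seq_limit_point_def comp_def)
    have "bounded (range (\<lambda>n. Poly_Mapping.lookup (y (t + r1 n)) \<alpha>))" for \<alpha>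
      by (rule bounded_subset[OF bounded_moment[of \<alpha>]]) auto
    then have "\<exists>r2 :: nat \<Rightarrow> nat. strict_mono r2 \<and>
        (\<forall>\<alpha>. convergent ((\<lambda>n. Poly_Mapping.lookup (y (t + r1 n)) \<alpha>) \<circ> r2))"
      by (intro diagonal_convergent_subsequence countable_expo)
    then
    obtain r2 :: "nat \<Rightarrow> nat" where r2: "strict_mono r2"
      and conv: "\<And>\<alpha>. convergent (\<lambda>n. Poly_Mapping.lookup (y (t + r1 (r2 n))) \<alpha>)"
      by (auto simp: comp_def)
    define r where "r n = t + r1 (r2 n)" for n
    have r: "strict_mono r" using r1 r2 by (simp add: strict_mono_def r_def)
    obtain \<phi> where \<phi>: "\<And>\<alpha>. (\<lambda>n. Poly_Mapping.lookup (y (r n)) \<alpha>) \<longlonglongrightarrow> \<phi> \<alpha>"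
      using conv unfolding convergent_def r_def by metis
    let ?L = "moment_functional \<phi>"
    interpret positive_functional ?L "max 1 R"
      by (rule limit_functional(2)[OF r \<phi>])
    \<comment> \<open>The point mass at a minimizer is feasible at every order, so the relaxations are bounded by
      the minimum \<open>c\<close>, and asymptotic optimality carries this bound over to the limit.\<close>
    have "?L f \<le> c"
    proof -
      obtain l :: ereal where l: "(\<lambda>k. ereal (riesz (y k) f)) \<longlonglongrightarrow> l" "mom_value f g \<longlonglongrightarrow> l"
        using asymptotically_optimal unfolding asymptotically_optimal_def by blast
      have "x0 \<in> feasible_set g" using x0 by (simp add: minimizers_def)
      then have "l \<le> ereal c"
        unfolding c_def
        by (intro LIMSEQ_le_const2[OF l(2)] exI[of _ ?m] allI impI mom_value_le_feasible_value)
      moreover have "(\<lambda>n. ereal (riesz (y (r n)) f)) \<longlonglongrightarrow> l"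
        using LIMSEQ_subseq_LIMSEQ[OF l(1) r] by (simp add: comp_def)
      then have "l = ereal (?L f)"
        using limit_functional(1)[OF r \<phi>, of f] by (intro LIMSEQ_unique) auto
      ultimately show ?thesis by simp
    qed
    from atomic_representation[OF finite_set _ min this S_eq minimizers_finite]
    obtain w where w: "\<forall>v\<in>?S. 0 \<le> w v" "sum w ?S = 1"
      and rep: "\<And>p. ?L p = (\<Sum>v\<in>?S. w v * poly_eval p v)"
      using limit_functional(3)[OF r \<phi>] by (auto simp: localizes_def)
    have lookup_z: "Poly_Mapping.lookup z \<alpha> = (if \<alpha> \<in> expos (2 * t) then \<phi> \<alpha> else 0)" for \<alpha>
    proof (rule LIMSEQ_unique)
      show "(\<lambda>n. Poly_Mapping.lookup (tms_trunc (2 * t) (y (r n))) \<alpha>) \<longlonglongrightarrow> Poly_Mapping.lookup z \<alpha>"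
        using LIMSEQ_subseq_LIMSEQ[OF tendsto_lookup[OF lim_z] r2] by (simp add: comp_def r_def)
      show "(\<lambda>n. Poly_Mapping.lookup (tms_trunc (2 * t) (y (r n))) \<alpha>)
          \<longlonglongrightarrow> (if \<alpha> \<in> expos (2 * t) then \<phi> \<alpha> else 0)"
        using \<phi>[of \<alpha>] by (simp add: lookup_tms_trunc)
    qed
    have atoms: "has_atoms ?S w (2 * t) z"
      using rep[of "monomial _"]
      by (auto simp: has_atoms_def tms_space_def in_keys_iff lookup_z split: if_splits)
    have t: "constr_deg g \<le> t" "card ?S - 1 \<le> t - constr_deg g"
      using order card unfolding max.bounded_iff by arith+
    have "z \<in> moment_set ?S (2 * t)"
      using w by (intro moment_set_atoms[OF minimizers_finite atoms]) auto
    moreover have "mom_feasible g t z"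
      by (rule mom_feasible_atoms[OF atoms]) (use w t in \<open>auto simp: minimizers_def\<close>)
    moreover have "moment_rank (t - constr_deg g) z = moment_rank t z"
      using moment_rank_atoms[OF minimizers_finite atoms, of "t - constr_deg g"]
        moment_rank_atoms[OF minimizers_finite atoms, of t] t by simp
    ultimately show ?thesis by (simp add: flat_tms_def)
  qed
  ultimately show ?thesis by blast
qed

end
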